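(* Let $\alpha\in(0,1)$ be a constant and $\varepsilon\in(0,1)$. Let $G_0,G_1,\dots,G_k$ be a sequence of graphs, $G_i=(V_i,E_i)$, where each $G_i$ is obtained from $G_{i-1}$ by one edge update $e_i=(u_i,v_i)$ (if $e_i\in E_{i-1}$ it is deleted, otherwise it is added). Let $n=|V_0|$, $m=|E_0|$, and let $\bar d$ be the average degree of $G_0$. Let $t$ be a uniformly random vertex of $G_0$. Then the (expected) total running time of maintaining, using the dynamic reverse push procedure described in the context, a reverse push solution $\overleftarrow{P}_i(\cdot,t)$ for each graph $G_i$ such that $|\overleftarrow{P}_i(s,t)-\pi_i(s,t)|\le\varepsilon$ for every $s\in V_i$, is at most $$O\!\left(\frac{k}{\alpha}+\frac{k}{n\varepsilon\alpha^2}+\frac{\bar d}{\alpha\varepsilon}\right)$$ in each of the following two dynamic graph models: (1) arbitrary edge updates of an undirected graph; (2) a random edge permutation of a directed graph, under the assumption that every vertex of $G_0$ has in-degree at least one and no new vertices are added during the edge arrivals.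
   Context: Personalized PageRank: for a graph with adjacency matrix $A$, diagonal out-degree matrix $D$ and teleport probability $\alpha$, $\vec\pi_s$ is the unique solution of $\vec\pi_s=\alpha\vec e_s+(1-\alpha)A^{\intercal}D^{-1}\vec\pi_s$, and $\pi(s,t)$ is its $t$-th entry; equivalently the probability that a random walk from $s$, which at each step stops with probability $\alpha$ and otherwise moves to a uniformly random out-neighbor, stops at $t$ (if the current vertex has no out-neighbor, the walk instead moves to $s$ with probability $1-\alpha$). $\pi_i$ denotes personalized PageRank on $G_i$; $d^{\mathrm{out}}_i,d^{\mathrm{in}}_i$ denote out/in-degrees in $G_i$. An undirected graph is treated as a directed graph with both orientations of each edge. Random edge permutation model: take a uniformly random ordering of $E_k$; $G_0$ consists of the first $m$ edges and $e_i$ is the $(m+i)$-th edge, $i=1,\dots,k$ (all updates are insertions). ReverseLocalPush$(t,\overleftarrow P,\overleftarrow R,G,\varepsilon)$: while some $u$ has $\overleftarrow R(u,t)>\varepsilon$, perform RevPush$(u)$; then while some $u$ has $\overleftarrow R(u,t)<-\varepsilon$, perform RevPush$(u)$. RevPush$(u)$: $\overleftarrow P(u,t)\mathrel{+}=\alpha\overleftarrow R(u,t)$; for each in-neighbor $v$ of $u$, $\overleftarrow R(v,t)\mathrel{+}=(1-\alpha)\overleftarrow R(u,t)/d^{\mathrm{out}}(v)$; then $\overleftarrow R(u,t)\gets 0$. Dynamic reverse push: initially run ReverseLocalPush on $G_0$ starting from $\overleftarrow P(\cdot,t)=0$, $\overleftarrow R(\cdot,t)=\vec e_t$. When directed edge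 $u\to v$ is inserted (degrees taken in the updated graph), set $\overleftarrow R(u,t)\mathrel{+}=\frac{(1-\alpha)\overleftarrow P(v,t)-\overleftarrow P(u,t)-\alpha\overleftarrow R(u,t)+\alpha\mathbf 1_{u=t}}{\alpha\, d^{\mathrm{out}}(u)}$; when it is deleted, subtract the same expression instead. For an undirected edge this is applied for both orientations. Then run ReverseLocalPush on the updated graph with the current vectors. The vectors satisfy $\pi(s,t)=\overleftarrow P(s,t)+\sum_x\pi(s,x)\overleftarrow R(x,t)$, and $\max_x|\overleftarrow R(x,t)|\le\varepsilon$ after each ReverseLocalPush. Cost model: a RevPush$(u)$ costs the in-degree of $u$ in the current graph; each insert/delete adjustment costs $O(1)$; the total running time is the initialization cost plus the cost of processing all $k$ updates.
   Formalization: The accuracy bound is claimed only for vertices s from which no vertex without out-neighbors is reachable in G_i (it fails e.g. for an isolated t, where P(t,t)=α but π(t,t)=1), and the O-constant may depend on the constant α. *)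

theory Defs
  imports "HOL-Probability.Probability" "Graph_Theory.Graph_Theory"
begin

text \<open>
  Graphs are finite loop-free digraphs without parallel arcs (\<^locale>\<open>pair_digraph\<close>); an undirected
  graph is one whose arc relation is symmetric (\<^locale>\<open>pair_graph\<close>).
\<close>

abbreviation outdeg :: "'v pair_pre_digraph \<Rightarrow> 'v \<Rightarrow> nat" where
  "outdeg G \<equiv> out_degree (with_proj G)"

abbreviation indeg :: "'v pair_pre_digraph \<Rightarrow> 'v \<Rightarrow> nat" where
  "indeg G \<equiv> in_degree (with_proj G)"

definition avg_degree :: "'v pair_pre_digraph \<Rightarrow> real" where
  "avg_degree G = (\<Sum>v\<in>pverts G. real (outdeg G v)) / real (card (pverts G))"


section \<open>Personalized PageRank\<close>

text \<open>
  The probability that the walk started in \<open>s\<close>, if it does not stop, moves from \<open>v\<close> to \<open>x\<close>. A vertex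
  without out-neighbours sends the walk back to \<open>s\<close>; otherwise this is the \<open>(v, x)\<close> entry of
  \<open>D\<close>-inverse times \<open>A\<close>.
\<close>
definition move_prob :: "'v pair_pre_digraph \<Rightarrow> 'v \<Rightarrow> 'v \<Rightarrow> 'v \<Rightarrow> real" where
  "move_prob G s v x =
     (if outdeg G v = 0 then of_bool (x = s) else of_bool ((v, x) \<in> parcs G) / real (outdeg G v))"

definition ppr_eq :: "real \<Rightarrow> 'v pair_pre_digraph \<Rightarrow> 'v \<Rightarrow> ('v \<Rightarrow> real) \<Rightarrow> bool" where
  "ppr_eq \<alpha> G s p \<longleftrightarrow>
     (\<forall>x. x \<notin> pverts G \<longrightarrow> p x = 0) \<and>
     (\<forall>x\<in>pverts G. p x = \<alpha> * of_bool (x = s) + (1 - \<alpha>) * (\<Sum>v\<in>pverts G. p v * move_prob G s v x))"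

definition ppr :: "real \<Rightarrow> 'v pair_pre_digraph \<Rightarrow> 'v \<Rightarrow> 'v \<Rightarrow> real" where
  "ppr \<alpha> G s = (THE p. ppr_eq \<alpha> G s p)"

lemma move_prob_nonneg: "0 \<le> move_prob G s v x"
  by (simp add: move_prob_def)

lemma (in pair_digraph) sum_move_prob:
  assumes "s \<in> pverts G"
  shows "(\<Sum>x\<in>pverts G. move_prob G s v x) = 1"
proof (cases "outdeg G v = 0")
  case True
  have "(\<Sum>x\<in>pverts G. of_bool (x = s) :: real) = (\<Sum>x\<in>{s}. 1)"
    using assms pair_finite_verts by (intro sum.mono_neutral_cong_right) auto
  with True show ?thesis by (simp add: move_prob_def)
next
  case False
  have "out_arcs (with_proj G) v = Pair v ` {x \<in> pverts G. (v, x) \<in> parcs G}"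
    using in_arcsD2 by (auto simp: out_arcs_def)
  then have "outdeg G v = card {x \<in> pverts G. (v, x) \<in> parcs G}"
    by (simp add: out_degree_def card_image inj_on_def)
  moreover have "(\<Sum>x\<in>pverts G. of_bool ((v, x) \<in> parcs G) :: real)
      = real (card {x \<in> pverts G. (v, x) \<in> parcs G})"
    using pair_finite_verts by (simp add: of_bool_def sum.If_cases Int_def conj_commute)
  ultimately have "(\<Sum>x\<in>pverts G. of_bool ((v, x) \<in> parcs G)) / real (outdeg G v) = 1"
    using False by simp
  then show ?thesis using False unfolding move_prob_def by (simp only: if_False sum_divide_distrib)
qed

lemma (in pair_digraph) ex1_ppr_eq:
  assumes "0 < \<alpha>" "\<alpha> < 1" and s: "s \<in> pverts G"
  shows "\<exists>!p. ppr_eq \<alpha> G s p"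
proof (rule ex_ex1I)
  define V where "V = pverts G"
  define W where "W = move_prob G s"
  define T where "T = (\<lambda>q x. \<Sum>v\<in>V. q v * W v x)"
  define q where "q = (\<lambda>l. (T ^^ l) (\<lambda>x. of_bool (x = s)) :: 'a \<Rightarrow> real)"
  have finV: "finite V" by (simp add: V_def pair_finite_verts)
  have W0: "W v x \<ge> 0" for v x by (simp add: W_def move_prob_nonneg)
  have sumW: "(\<Sum>x\<in>V. W v x) = 1" for v by (simp add: W_def V_def sum_move_prob s)
  have q0: "q 0 x = of_bool (x = s)" and qS: "q (Suc l) x = (\<Sum>v\<in>V. q l v * W v x)" for l x
    by (simp_all add: q_def T_def)
  have qnn: "q l x \<ge> 0" for l x
    by (induction l arbitrary: x) (auto simp: q0 qS W0 intro!: sum_nonneg)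
  have qsum: "(\<Sum>x\<in>V. q l x) = 1" for l
  proof (induction l)
    case 0
    have "(\<Sum>x\<in>V. q 0 x) = (\<Sum>x\<in>{s}. 1)"
      using s finV by (intro sum.mono_neutral_cong_right) (auto simp: q0 V_def)
    then show ?case by simp
  next
    case (Suc l)
    have "(\<Sum>x\<in>V. q (Suc l) x) = (\<Sum>v\<in>V. q l v * (\<Sum>x\<in>V. W v x))"
      unfolding qS sum_distrib_left by (rule sum.swap)
    then show ?case by (simp add: sumW Suc)
  qed
  have qle: "q l x \<le> 1" if "x \<in> V" for l x
    using member_le_sum[of x V "q l"] that finV qnn qsum[of l] by auto
  have summ: "summable (\<lambda>l. (1 - \<alpha>) ^ l * q l x)" if "x \<in> V" for x
    by (rule summable_comparison_test'[of "\<lambda>l. (1 - \<alpha>) ^ l" 0])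
      (use assms qle[OF that] qnn in \<open>auto simp: abs_mult power_abs mult_left_le intro!: summable_geometric\<close>)
  define f where "f = (\<lambda>x. \<Sum>l. (1 - \<alpha>) ^ l * q l x)"
  define p where "p = (\<lambda>x. if x \<in> V then \<alpha> * f x else 0)"
  have f_eq: "f x = of_bool (x = s) + (1 - \<alpha>) * (\<Sum>v\<in>V. f v * W v x)" if x: "x \<in> V" for x
  proof -
    have "f x = (1 - \<alpha>) ^ 0 * q 0 x + (\<Sum>l. (1 - \<alpha>) ^ Suc l * q (Suc l) x)"
      unfolding f_def using suminf_split_head[OF summ[OF x]] by simp
    also have "(\<lambda>l. (1 - \<alpha>) ^ Suc l * q (Suc l) x)
        = (\<lambda>l. \<Sum>v\<in>V. (1 - \<alpha>) * W v x * ((1 - \<alpha>) ^ l * q l v))"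
      by (simp add: qS sum_distrib_left mult_ac)
    also have "(\<Sum>l. \<Sum>v\<in>V. (1 - \<alpha>) * W v x * ((1 - \<alpha>) ^ l * q l v))
        = (\<Sum>v\<in>V. \<Sum>l. (1 - \<alpha>) * W v x * ((1 - \<alpha>) ^ l * q l v))"
      by (rule suminf_sum) (intro summable_mult summ)
    also have "\<dots> = (\<Sum>v\<in>V. (1 - \<alpha>) * W v x * f v)"
      unfolding f_def by (intro sum.cong refl suminf_mult summ)
    finally show ?thesis by (simp add: q0 sum_distrib_left mult_ac)
  qed
  have "ppr_eq \<alpha> G s p"
    unfolding ppr_eq_def V_def[symmetric] W_def[symmetric]
  proof (intro conjI allI impI ballI)
    fix x assume x: "x \<in> V"
    have "(\<Sum>v\<in>V. p v * W v x) = \<alpha> * (\<Sum>v\<in>V. f v * W v x)"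
      by (simp add: p_def sum_distrib_left mult_ac)
    moreover have "p x = \<alpha> * f x" using x by (simp add: p_def)
    ultimately show "p x = \<alpha> * of_bool (x = s) + (1 - \<alpha>) * (\<Sum>v\<in>V. p v * W v x)"
      using f_eq[OF x] by (simp only: ring_distribs mult_ac)
  qed (simp add: p_def)
  then show "\<exists>p. ppr_eq \<alpha> G s p" by blast
  fix p p' assume p: "ppr_eq \<alpha> G s p" and p': "ppr_eq \<alpha> G s p'"
  define d where "d = (\<lambda>x. p x - p' x)"
  have d_eq: "d x = (1 - \<alpha>) * (\<Sum>v\<in>V. d v * W v x)" if "x \<in> V" for x
  proof -
    have eq: "r x = \<alpha> * of_bool (x = s) + (1 - \<alpha>) * (\<Sum>v\<in>V. r v * W v x)" if "ppr_eq \<alpha> G s r" for r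
      using that \<open>x \<in> V\<close> unfolding ppr_eq_def V_def[symmetric] W_def[symmetric] by blast
    have "d x = (1 - \<alpha>) * (\<Sum>v\<in>V. p v * W v x) - (1 - \<alpha>) * (\<Sum>v\<in>V. p' v * W v x)"
      unfolding d_def using eq[OF p] eq[OF p'] by linarith
    then show ?thesis
      by (simp add: d_def left_diff_distrib sum_subtractf right_diff_distrib)
  qed
  have "(\<Sum>x\<in>V. \<bar>d x\<bar>) \<le> (\<Sum>x\<in>V. (1 - \<alpha>) * (\<Sum>v\<in>V. \<bar>d v\<bar> * W v x))"
  proof (rule sum_mono)
    fix x assume "x \<in> V"
    have "\<bar>\<Sum>v\<in>V. d v * W v x\<bar> \<le> (\<Sum>v\<in>V. \<bar>d v\<bar> * W v x)"
      by (rule order_trans[OF sum_abs]) (simp add: abs_mult W0)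
    with assms show "\<bar>d x\<bar> \<le> (1 - \<alpha>) * (\<Sum>v\<in>V. \<bar>d v\<bar> * W v x)"
      by (subst d_eq[OF \<open>x \<in> V\<close>]) (simp add: abs_mult)
  qed
  also have "\<dots> = (1 - \<alpha>) * (\<Sum>v\<in>V. \<bar>d v\<bar> * (\<Sum>x\<in>V. W v x))"
    unfolding sum_distrib_left[symmetric] by (subst sum.swap) (simp add: sum_distrib_left)
  finally have "\<alpha> * (\<Sum>x\<in>V. \<bar>d x\<bar>) \<le> 0" by (simp add: sumW algebra_simps)
  with assms have "(\<Sum>x\<in>V. \<bar>d x\<bar>) \<le> 0" by (simp add: mult_le_0_iff)
  then have "(\<Sum>x\<in>V. \<bar>d x\<bar>) = 0" by (intro antisym sum_nonneg) auto
  then have "\<forall>x\<in>V. d x = 0" using finV by (simp add: sum_nonneg_eq_0_iff)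
  moreover have "\<forall>x. x \<notin> V \<longrightarrow> p x = 0 \<and> p' x = 0"
    using p p' unfolding ppr_eq_def V_def by blast
  ultimately have "p x = p' x" for x
    by (cases "x \<in> V") (auto simp: d_def)
  then show "p = p'" by blast
qed


section \<open>Dynamic reverse push\<close>

text \<open>The vectors \<open>P(\<cdot>, t)\<close> and \<open>R(\<cdot>, t)\<close> for a fixed target \<open>t\<close>.\<close>
type_synonym 'v push_state = "('v \<Rightarrow> real) \<times> ('v \<Rightarrow> real)"

definition rev_push :: "real \<Rightarrow> 'v pair_pre_digraph \<Rightarrow> 'v \<Rightarrow> 'v push_state \<Rightarrow> 'v push_state" where
  "rev_push \<alpha> G u = (\<lambda>(P, R).
     (P(u := P u + \<alpha> * R u),
      (\<lambda>v. R v + of_bool ((v, u) \<in> parcs G) * ((1 - \<alpha>) * R u / real (outdeg G v)))(u := 0)))"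

text \<open>
  Here \<open>G\<close> is the updated graph, so the arc was inserted iff it is an arc of \<open>G\<close>. If the deleted
  arc was the last one leaving \<open>u\<close>, the correction has no meaning (\<open>outdeg G u = 0\<close>); division by
  zero then makes it \<open>0\<close>, i.e.\ the residual is left alone.
\<close>
definition adjust ::
  "real \<Rightarrow> 'v \<Rightarrow> 'v pair_pre_digraph \<Rightarrow> 'v \<times> 'v \<Rightarrow> 'v push_state \<Rightarrow> 'v push_state" where
  "adjust \<alpha> t G = (\<lambda>(u, v) (P, R).
     let \<delta> = ((1 - \<alpha>) * P v - P u - \<alpha> * R u + \<alpha> * of_bool (u = t)) / (\<alpha> * real (outdeg G u))
     in (P, R(u := if (u, v) \<in> parcs G then R u + \<delta> else R u - \<delta>)))"

datatype push_phase = Positive | Negative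

text \<open>
  \<open>(i, ph, S)\<close>: reverse local push is running on the \<open>i\<close>-th graph, in its first (\<open>Positive\<close>) or
  second (\<open>Negative\<close>) loop, with current vectors \<open>S\<close>.
\<close>
type_synonym 'v config = "nat \<times> push_phase \<times> 'v push_state"

text \<open>
  One step of the procedure on the graphs \<open>G 0, \<dots>, G k\<close>, labelled with its cost; \<open>upd i\<close> lists the
  arcs flipped between \<open>G (i - 1)\<close> and \<open>G i\<close>. The vertex to be pushed is chosen nondeterministically.
\<close>
inductive push_step ::
  "real \<Rightarrow> real \<Rightarrow> 'v \<Rightarrow> (nat \<Rightarrow> 'v pair_pre_digraph) \<Rightarrow> (nat \<Rightarrow> ('v \<times> 'v) list) \<Rightarrow> nat \<Rightarrow>
   'v config \<Rightarrow> nat \<Rightarrow> 'v config \<Rightarrow> bool"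
  for \<alpha> \<epsilon> t G upd k where
  push_pos: "u \<in> pverts (G i) \<Longrightarrow> snd S u > \<epsilon> \<Longrightarrow>
    push_step \<alpha> \<epsilon> t G upd k (i, Positive, S) (indeg (G i) u) (i, Positive, rev_push \<alpha> (G i) u S)"
| to_neg: "\<forall>u\<in>pverts (G i). snd S u \<le> \<epsilon> \<Longrightarrow>
    push_step \<alpha> \<epsilon> t G upd k (i, Positive, S) 0 (i, Negative, S)"
| push_neg: "u \<in> pverts (G i) \<Longrightarrow> snd S u < - \<epsilon> \<Longrightarrow>
    push_step \<alpha> \<epsilon> t G upd k (i, Negative, S) (indeg (G i) u) (i, Negative, rev_push \<alpha> (G i) u S)"
| update: "i < k \<Longrightarrow> \<forall>u\<in>pverts (G i). - \<epsilon> \<le> snd S u \<Longrightarrow>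
    push_step \<alpha> \<epsilon> t G upd k (i, Negative, S) (length (upd (Suc i)))
      (Suc i, Positive, fold (adjust \<alpha> t (G (Suc i))) (upd (Suc i)) S)"

definition init_config :: "'v \<Rightarrow> 'v config" where
  "init_config t = (0, Positive, (\<lambda>_. 0), (\<lambda>x. of_bool (x = t)))"

text \<open>\<open>push_exec \<alpha> \<epsilon> t G upd k c x\<close>: some (partial) execution of total cost \<open>c\<close> leads to \<open>x\<close>.\<close>
inductive push_exec ::
  "real \<Rightarrow> real \<Rightarrow> 'v \<Rightarrow> (nat \<Rightarrow> 'v pair_pre_digraph) \<Rightarrow> (nat \<Rightarrow> ('v \<times> 'v) list) \<Rightarrow> nat \<Rightarrow>
   nat \<Rightarrow> 'v config \<Rightarrow> bool"
  for \<alpha> \<epsilon> t G upd k where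
  start: "push_exec \<alpha> \<epsilon> t G upd k 0 (init_config t)"
| step: "push_exec \<alpha> \<epsilon> t G upd k c x \<Longrightarrow> push_step \<alpha> \<epsilon> t G upd k x c' y \<Longrightarrow>
    push_exec \<alpha> \<epsilon> t G upd k (c + c') y"

text \<open>Total running time for target \<open>t\<close>, in the worst case over the choices of pushed vertices.\<close>
definition running_time ::
  "real \<Rightarrow> real \<Rightarrow> 'v \<Rightarrow> (nat \<Rightarrow> 'v pair_pre_digraph) \<Rightarrow> (nat \<Rightarrow> ('v \<times> 'v) list) \<Rightarrow> nat \<Rightarrow> ennreal"
  where
  "running_time \<alpha> \<epsilon> t G upd k = (SUP c \<in> {c. \<exists>x. push_exec \<alpha> \<epsilon> t G upd k c x}. of_nat c)"

text \<open>
  The invariant of reverse push presupposes that the walk from \<open>s\<close> only meets vertices where the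
  out-degree matrix is invertible: on a single isolated vertex \<open>t\<close> the procedure ends with
  \<open>P(t, t) = \<alpha>\<close>, whereas \<open>\<pi>(t, t) = 1\<close>.
\<close>
definition no_dead_end :: "'v pair_pre_digraph \<Rightarrow> 'v \<Rightarrow> bool" where
  "no_dead_end G s \<longleftrightarrow> (\<forall>x. reachable (with_proj G) s x \<longrightarrow> outdeg G x > 0)"

text \<open>
  Every execution terminates, and whenever reverse local push has finished on \<open>G i\<close>, the vector \<open>P\<close>
  is \<open>\<epsilon>\<close>-accurate.
\<close>
definition maintains_ppr ::
  "real \<Rightarrow> real \<Rightarrow> 'v \<Rightarrow> (nat \<Rightarrow> 'v pair_pre_digraph) \<Rightarrow> (nat \<Rightarrow> ('v \<times> 'v) list) \<Rightarrow> nat \<Rightarrow> bool"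
  where
  "maintains_ppr \<alpha> \<epsilon> t G upd k \<longleftrightarrow>
     (\<nexists>x c. x 0 = init_config t \<and> (\<forall>j. push_step \<alpha> \<epsilon> t G upd k (x j) (c j) (x (Suc j)))) \<and>
     (\<forall>c i P R. push_exec \<alpha> \<epsilon> t G upd k c (i, Negative, P, R) \<and> (\<forall>u\<in>pverts (G i). - \<epsilon> \<le> R u) \<longrightarrow>
        (\<forall>s\<in>pverts (G i). no_dead_end (G i) s \<longrightarrow> \<bar>P s - ppr \<alpha> (G i) s t\<bar> \<le> \<epsilon>))"


section \<open>Dynamic graph models\<close>

text \<open>Flipping an undirected edge; endpoints not yet present become vertices.\<close>
definition flip_edge :: "'v \<times> 'v \<Rightarrow> 'v pair_pre_digraph \<Rightarrow> 'v pair_pre_digraph" where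
  "flip_edge = (\<lambda>(u, v) G.
     \<lparr>pverts = pverts G \<union> {u, v},
      parcs = (if (u, v) \<in> parcs G then parcs G - {(u, v), (v, u)} else parcs G \<union> {(u, v), (v, u)})\<rparr>)"

definition undirected_updates ::
  "(nat \<Rightarrow> 'v pair_pre_digraph) \<Rightarrow> (nat \<Rightarrow> 'v \<times> 'v) \<Rightarrow> nat \<Rightarrow> bool" where
  "undirected_updates G e k \<longleftrightarrow>
     pair_graph (G 0) \<and> pverts (G 0) \<noteq> {} \<and>
     (\<forall>i\<in>{1..k}. fst (e i) \<noteq> snd (e i) \<and> G i = flip_edge (e i) (G (i - 1)))"

definition both_arcs :: "(nat \<Rightarrow> 'v \<times> 'v) \<Rightarrow> nat \<Rightarrow> ('v \<times> 'v) list" where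
  "both_arcs e i = [e i, prod.swap (e i)]"

text \<open>For an ordering \<open>\<sigma>\<close> of the arcs: \<open>G\<^sub>i\<close> has the first \<open>m + i\<close> arcs.\<close>
definition arrival_graph :: "'v set \<Rightarrow> nat \<Rightarrow> ('v \<times> 'v) list \<Rightarrow> nat \<Rightarrow> 'v pair_pre_digraph" where
  "arrival_graph V m \<sigma> i = \<lparr>pverts = V, parcs = set (take (m + i) \<sigma>)\<rparr>"

definition arrival_arc :: "nat \<Rightarrow> ('v \<times> 'v) list \<Rightarrow> nat \<Rightarrow> ('v \<times> 'v) list" where
  "arrival_arc m \<sigma> i = [\<sigma> ! (m + i - 1)]"

text \<open>
  The orderings of the arcs of \<open>H\<close> in which every vertex has in-degree at least one in \<open>G\<^sub>0\<close>. Since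
  \<open>G\<^sub>0\<close> depends on the ordering, assuming this property amounts to drawing the ordering uniformly
  from this set.
\<close>
definition admissible_orderings :: "'v pair_pre_digraph \<Rightarrow> nat \<Rightarrow> ('v \<times> 'v) list set" where
  "admissible_orderings H m =
     {\<sigma> \<in> permutations_of_set (parcs H). \<forall>v\<in>pverts H. indeg (arrival_graph (pverts H) m \<sigma> 0) v \<ge> 1}"

end

theory Submission
  imports Defs
begin

text \<open>
  Let \<open>w\<close> satisfy \<open>w(x) \<ge> \<alpha> indeg(x) + (1 - \<alpha>) (\<Sum>v\<rightarrow>x. w(v) / outdeg(v))\<close>. Pushing \<open>u\<close> then decreases
  \<open>\<Phi> = (\<Sum>x. w(x) \<bar>R(x)\<bar>)\<close> by at least \<open>\<alpha> \<epsilon> indeg(u)\<close>, so \<open>\<alpha> \<epsilon>\<close> times the push cost is at most the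
  initial value of \<open>\<Phi>\<close> plus its increments at the updates. Flipping \<open>(u, v)\<close> changes \<open>R(u)\<close> by
  \<open>O(P(u) + P(v) + \<epsilon> + [u = t]) / (\<alpha> outdeg(u))\<close>, and between updates \<open>P(u, t) \<le> B(u, t) + \<epsilon>\<close> for a
  deterministic \<open>B\<close> with \<open>(\<Sum>t. B(u, t)) \<le> 1\<close>, which makes the average of this numerator \<open>O(1/n + \<epsilon>)\<close>.
  It remains to bound \<open>w(u) / outdeg(u)\<close> for the tail \<open>u\<close> of the updated arc, as this also controls the
  growth of \<open>w\<close>.

  For undirected graphs \<open>w = outdeg\<close> and the ratio is \<open>1\<close>. For a random arrival order take equality in the
  condition on \<open>w\<close>. Given the set \<open>S\<close> of arcs present, conditioning on positive initial in-degrees destroys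
  the uniform distribution of the last arc, but an arc whose head has in-degree one is never last, and by
  relabelling the arcs any two others are last with probabilities within a factor \<open>2\<close>. The arcs that can be
  last thus have average ratio \<open>O(1 / \<alpha>)\<close>, because the mass of \<open>w\<close> exceeding \<open>1\<close> only originates from them.
\<close>

section \<open>Degrees as cardinalities of neighbour sets\<close>

lemma outdeg_eq_card: "outdeg G u = card {y. (u, y) \<in> parcs G}"
proof -
  have "out_arcs (with_proj G) u = Pair u ` {y. (u, y) \<in> parcs G}"
    by (auto simp: out_arcs_def)
  then show ?thesis by (simp add: out_degree_def card_image inj_on_def)
qed

lemma indeg_eq_card: "indeg G u = card {v. (v, u) \<in> parcs G}"
proof -
  have "in_arcs (with_proj G) u = (\<lambda>v. (v, u)) ` {v. (v, u) \<in> parcs G}"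
    by (auto simp: in_arcs_def)
  then show ?thesis by (simp add: in_degree_def card_image inj_on_def)
qed

section \<open>The Green function of the killed walk\<close>

text \<open>Division by zero makes the row of a vertex without out-neighbours vanish. Unlike
  \<open>move_prob\<close>, this matrix does not depend on the source, so it serves all walks at
  once.\<close>

definition arc_prob :: "'v pair_pre_digraph \<Rightarrow> 'v \<Rightarrow> 'v \<Rightarrow> real" where
  "arc_prob G v x = of_bool ((v, x) \<in> parcs G) / real (outdeg G v)"

text \<open>Unlike in \<^const>\<open>ppr\<close>, the walk dies at a vertex without out-neighbours.\<close>
definition green :: "real \<Rightarrow> 'v pair_pre_digraph \<Rightarrow> 'v \<Rightarrow> 'v \<Rightarrow> real" where
  "green \<alpha> G s x = (\<Sum>l. (1 - \<alpha>) ^ l *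
     ((\<lambda>q y. \<Sum>v\<in>pverts G. q v * arc_prob G v y) ^^ l) (\<lambda>y. of_bool (y = s)) x)"

text \<open>Solves the balance equation of a Lyapunov weight for the residuals (with cost \<open>g\<close>): pushing
  \<open>u\<close> decreases the weighted \<open>L\<^sup>1\<close> norm of the residuals by \<open>\<alpha> g(u) \<bar>R(u)\<bar>\<close>.\<close>
definition push_weight :: "real \<Rightarrow> 'v pair_pre_digraph \<Rightarrow> ('v \<Rightarrow> real) \<Rightarrow> 'v \<Rightarrow> real" where
  "push_weight \<alpha> G g x = (if x \<in> pverts G then \<alpha> * (\<Sum>s\<in>pverts G. g s * green \<alpha> G s x) else 0)"

lemma arc_prob_nonneg: "0 \<le> arc_prob G v x"
  by (simp add: arc_prob_def)

context pair_digraph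
begin

section \<open>Sums over arcs and the rows of the transition matrix\<close>

lemma finite_out: "finite {y. (u, y) \<in> parcs G}"
  by (rule finite_subset[OF _ pair_finite_verts]) (auto dest: in_arcsD2)

lemma finite_in: "finite {v. (v, u) \<in> parcs G}"
  by (rule finite_subset[OF _ pair_finite_verts]) (auto dest: in_arcsD1)

lemma outdeg_pos: "(u, v) \<in> parcs G \<Longrightarrow> outdeg G u > 0"
  using finite_out[of u] by (auto simp: outdeg_eq_card card_gt_0_iff)

lemma outdeg_outside: "u \<notin> pverts G \<Longrightarrow> outdeg G u = 0"
  by (auto simp: outdeg_eq_card dest: in_arcsD1 intro!: card_eq_0_iff[THEN iffD2])

lemma sum_out: "(\<Sum>x\<in>pverts G. of_bool ((v, x) \<in> parcs G) * f x) = (\<Sum>x | (v, x) \<in> parcs G. f x :: real)"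
  by (rule sum.mono_neutral_cong_right) (use pair_finite_verts in \<open>auto dest: in_arcsD2\<close>)

lemma sum_in: "(\<Sum>v\<in>pverts G. f v * of_bool ((v, x) \<in> parcs G)) = (\<Sum>v | (v, x) \<in> parcs G. f v :: real)"
  by (rule sum.mono_neutral_cong_right) (use pair_finite_verts in \<open>auto dest: in_arcsD1\<close>)

lemma sum_arcs: "(\<Sum>a\<in>parcs G. f a) = (\<Sum>v\<in>pverts G. \<Sum>u | (u, v) \<in> parcs G. f (u, v) :: real)"
proof -
  have "(\<Sum>a\<in>parcs G. f a) = (\<Sum>a\<in>(\<Union>v\<in>pverts G. (\<lambda>u. (u, v)) ` {u. (u, v) \<in> parcs G}). f a)"
    by (intro arg_cong2[where f = sum] refl) (auto dest: in_arcsD2)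
  also have "\<dots> = (\<Sum>v\<in>pverts G. \<Sum>a\<in>(\<lambda>u. (u, v)) ` {u. (u, v) \<in> parcs G}. f a)"
    by (rule sum.UNION_disjoint) (use finite_in pair_finite_verts in auto)
  also have "\<dots> = (\<Sum>v\<in>pverts G. \<Sum>u | (u, v) \<in> parcs G. f (u, v))"
    by (intro sum.cong refl) (simp add: sum.reindex inj_on_def)
  finally show ?thesis .
qed

lemma sum_indeg: "(\<Sum>x\<in>pverts G. real (indeg G x)) = real (card (parcs G))"
  using sum_arcs[of "\<lambda>_. 1"] by (simp add: indeg_eq_card)

lemma sum_arc_prob: "(\<Sum>x\<in>pverts G. arc_prob G v x) = of_bool (outdeg G v \<noteq> 0)"
proof -
  have "(\<Sum>x\<in>pverts G. arc_prob G v x) = (\<Sum>x\<in>pverts G. of_bool ((v, x) \<in> parcs G) * (1 / outdeg G v))"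
    by (simp add: arc_prob_def)
  also have "\<dots> = of_bool (outdeg G v \<noteq> 0)"
    unfolding sum_out by (simp add: outdeg_eq_card)
  finally show ?thesis .
qed

lemma arc_prob_loop: "arc_prob G v v = 0"
  using pair_no_loops[of "(v, v)"] by (auto simp: arc_prob_def)

context
  fixes \<alpha> :: real
  assumes \<alpha>: "0 < \<alpha>" "\<alpha> < 1"
begin

text \<open>Neumann series: \<open>q l\<close> is the law after \<open>l\<close> moves and
  \<open>(1 - \<alpha>) ^ l\<close> the chance of not having stopped before. The mass of
  \<open>q l\<close> is at most \<open>1\<close>, so the series converges geometrically; splitting
  off \<open>l = 0\<close> gives the equation.\<close>

lemma green_props:
  assumes s: "s \<in> pverts G"
  shows green_eq: "x \<in> pverts G \<Longrightarrow> green \<alpha> G s x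
      = of_bool (x = s) + (1 - \<alpha>) * (\<Sum>v\<in>pverts G. green \<alpha> G s v * arc_prob G v x)"
    and green_nonneg: "x \<in> pverts G \<Longrightarrow> 0 \<le> green \<alpha> G s x"
    and green_unreachable: "\<not> reachable (with_proj G) s x \<Longrightarrow> green \<alpha> G s x = 0"
proof -
  define q where "q l = ((\<lambda>q y. \<Sum>v\<in>pverts G. q v * arc_prob G v y) ^^ l) (\<lambda>y. of_bool (y = s))" for l
  have green: "green \<alpha> G s x = (\<Sum>l. (1 - \<alpha>) ^ l * q l x)" for x
    by (simp add: green_def q_def)
  have q0: "q 0 x = of_bool (x = s)" and qS: "q (Suc l) x = (\<Sum>v\<in>pverts G. q l v * arc_prob G v x)" for l x
    by (simp_all add: q_def)
  have qnn: "q l x \<ge> 0" for l x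
    by (induction l arbitrary: x) (auto simp: q0 qS arc_prob_nonneg intro!: sum_nonneg)
  have qsum: "(\<Sum>x\<in>pverts G. q l x) \<le> 1" for l
  proof (induction l)
    case 0
    show ?case using s pair_finite_verts by (simp add: q0 of_bool_def sum.delta)
  next
    case (Suc l)
    have "(\<Sum>x\<in>pverts G. q (Suc l) x) = (\<Sum>v\<in>pverts G. q l v * (\<Sum>x\<in>pverts G. arc_prob G v x))"
      unfolding qS sum_distrib_left by (rule sum.swap)
    \<comment> \<open>Only an inequality: mass is lost at vertices without out-neighbours.\<close>
    also have "\<dots> \<le> (\<Sum>v\<in>pverts G. q l v)"
      by (intro sum_mono) (simp add: sum_arc_prob mult_left_le qnn)
    finally show ?case using Suc by simp
  qed
  have qle: "q l x \<le> 1" if "x \<in> pverts G" for l x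
    using member_le_sum[of x "pverts G" "q l"] that pair_finite_verts qnn qsum[of l] by force
  have summ: "summable (\<lambda>l. (1 - \<alpha>) ^ l * q l x)" if "x \<in> pverts G" for x
    by (rule summable_comparison_test'[of "\<lambda>l. (1 - \<alpha>) ^ l" 0])
      (use \<alpha> qle[OF that] qnn in \<open>auto simp: abs_mult power_abs mult_left_le intro!: summable_geometric\<close>)
  show "green \<alpha> G s x = of_bool (x = s) + (1 - \<alpha>) * (\<Sum>v\<in>pverts G. green \<alpha> G s v * arc_prob G v x)"
    if x: "x \<in> pverts G"
  proof -
    have "green \<alpha> G s x = (1 - \<alpha>) ^ 0 * q 0 x + (\<Sum>l. (1 - \<alpha>) ^ Suc l * q (Suc l) x)"
      unfolding green using suminf_split_head[OF summ[OF x]] by simp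
    also have "(\<lambda>l. (1 - \<alpha>) ^ Suc l * q (Suc l) x)
        = (\<lambda>l. \<Sum>v\<in>pverts G. (1 - \<alpha>) * arc_prob G v x * ((1 - \<alpha>) ^ l * q l v))"
      by (simp add: qS sum_distrib_left mult_ac)
    also have "(\<Sum>l. \<Sum>v\<in>pverts G. (1 - \<alpha>) * arc_prob G v x * ((1 - \<alpha>) ^ l * q l v))
        = (\<Sum>v\<in>pverts G. \<Sum>l. (1 - \<alpha>) * arc_prob G v x * ((1 - \<alpha>) ^ l * q l v))"
      by (rule suminf_sum) (intro summable_mult summ)
    also have "\<dots> = (\<Sum>v\<in>pverts G. (1 - \<alpha>) * arc_prob G v x * green \<alpha> G s v)"
      unfolding green by (intro sum.cong refl suminf_mult summ)
    finally show ?thesis by (simp add: q0 sum_distrib_left mult_ac)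
  qed
  show "0 \<le> green \<alpha> G s x" if "x \<in> pverts G"
    unfolding green using \<alpha> qnn by (intro suminf_nonneg summ that) auto
  have "q l x = 0" if "\<not> reachable (with_proj G) s x" for l x
    using that
  proof (induction l arbitrary: x)
    case 0
    then show ?case using s by (auto simp: q0)
  next
    case (Suc l)
    have "q l v * arc_prob G v x = 0" if "v \<in> pverts G" for v
    proof (cases "(v, x) \<in> parcs G")
      case True
      then have "\<not> reachable (with_proj G) s v" using Suc.prems reachable_adj_trans by fastforce
      then show ?thesis using Suc.IH by simp
    qed (simp add: arc_prob_def)
    then show ?case unfolding qS by (intro sum.neutral) simp
  qed
  then show "\<not> reachable (with_proj G) s x \<Longrightarrow> green \<alpha> G s x = 0"
    by (simp add: green)
qed

text \<open>Conservation of probability: a visit ends the killed walk with probability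
  \<open>1\<close> at a dead end and \<alpha> elsewhere, and the walk ends exactly once.\<close>

lemma green_mass:
  assumes s: "s \<in> pverts G"
  shows "(\<Sum>x\<in>pverts G. green \<alpha> G s x * (if outdeg G x = 0 then 1 else \<alpha>)) = 1"
proof -
  have "(\<Sum>x\<in>pverts G. green \<alpha> G s x)
      = (\<Sum>x\<in>pverts G. of_bool (x = s)) + (1 - \<alpha>) * (\<Sum>x\<in>pverts G. \<Sum>v\<in>pverts G. green \<alpha> G s v * arc_prob G v x)"
    by (simp add: green_eq[OF s] sum.distrib sum_distrib_left cong: sum.cong)
  also have "(\<Sum>x\<in>pverts G. \<Sum>v\<in>pverts G. green \<alpha> G s v * arc_prob G v x)
      = (\<Sum>v\<in>pverts G. green \<alpha> G s v * of_bool (outdeg G v \<noteq> 0))"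
    by (subst sum.swap) (simp flip: sum_distrib_left add: sum_arc_prob)
  also have "(\<Sum>x\<in>pverts G. of_bool (x = s) :: real) = 1"
    using s pair_finite_verts by (simp add: of_bool_def sum.delta)
  finally have "(\<Sum>x\<in>pverts G. green \<alpha> G s x) - (1 - \<alpha>) * (\<Sum>v\<in>pverts G. green \<alpha> G s v * of_bool (outdeg G v \<noteq> 0)) = 1"
    by simp
  moreover have "(\<Sum>x\<in>pverts G. green \<alpha> G s x * (if outdeg G x = 0 then 1 else \<alpha>))
      = (\<Sum>x\<in>pverts G. green \<alpha> G s x - (1 - \<alpha>) * (green \<alpha> G s x * of_bool (outdeg G x \<noteq> 0)))"
    by (intro sum.cong) (auto simp: algebra_simps)
  ultimately show ?thesis
    by (simp only: sum_subtractf sum_distrib_left)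
qed

lemma green_sum_le:
  assumes s: "s \<in> pverts G"
  shows "\<alpha> * (\<Sum>x\<in>pverts G. green \<alpha> G s x) \<le> 1"
proof -
  have "\<alpha> * (\<Sum>x\<in>pverts G. green \<alpha> G s x) \<le> (\<Sum>x\<in>pverts G. green \<alpha> G s x * (if outdeg G x = 0 then 1 else \<alpha>))"
    unfolding sum_distrib_left mult.commute[of \<alpha>]
    using \<alpha> green_nonneg[OF s] by (intro sum_mono mult_left_mono) auto
  with green_mass[OF s] show ?thesis by simp
qed

text \<open>\<open>green\<close> inverts the identity minus \<open>(1 - \<alpha>)\<close> times
  \<open>arc_prob\<close>, so any vector is recovered from its local defects. This is the global
  form of the push invariant, valid also in the presence of dead ends.\<close>

lemma green_inverse:
  assumes s: "s \<in> pverts G"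
  shows "P s = (\<Sum>x\<in>pverts G. green \<alpha> G s x * (P x - (1 - \<alpha>) * (\<Sum>y\<in>pverts G. arc_prob G x y * P y)))"
proof -
  have "(\<Sum>x\<in>pverts G. green \<alpha> G s x * ((1 - \<alpha>) * (\<Sum>y\<in>pverts G. arc_prob G x y * P y)))
     = (\<Sum>x\<in>pverts G. \<Sum>y\<in>pverts G. (1 - \<alpha>) * (green \<alpha> G s x * arc_prob G x y) * P y)"
    by (simp add: sum_distrib_left mult_ac)
  also have "\<dots> = (\<Sum>y\<in>pverts G. (\<Sum>x\<in>pverts G. (1 - \<alpha>) * (green \<alpha> G s x * arc_prob G x y)) * P y)"
    by (subst sum.swap) (simp add: sum_distrib_right)
  also have "\<dots> = (\<Sum>y\<in>pverts G. (green \<alpha> G s y - of_bool (y = s)) * P y)"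
    by (intro sum.cong refl) (simp add: green_eq[OF s] sum_distrib_left)
  also have "\<dots> = (\<Sum>y\<in>pverts G. green \<alpha> G s y * P y) - (\<Sum>y\<in>pverts G. of_bool (y = s) * P y)"
    by (simp add: left_diff_distrib sum_subtractf)
  also have "(\<Sum>y\<in>pverts G. of_bool (y = s) * P y) = (\<Sum>y\<in>{s}. P y)"
    using s pair_finite_verts by (intro sum.mono_neutral_cong_right) auto
  finally show ?thesis by (simp add: right_diff_distrib sum_subtractf)
qed

text \<open>If no dead end is reachable, \<open>move_prob\<close> and \<open>arc_prob\<close> agree
  wherever \<open>green\<close> is nonzero, so \<alpha> times \<open>green\<close> solves the
  equation whose unique solution is \<open>ppr\<close>.\<close>

lemma ppr_eq_green:
  assumes s: "s \<in> pverts G" and nd: "no_dead_end G s"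
  shows "x \<in> pverts G \<Longrightarrow> ppr \<alpha> G s x = \<alpha> * green \<alpha> G s x"
proof -
  let ?p = "\<lambda>x. if x \<in> pverts G then \<alpha> * green \<alpha> G s x else 0"
  have *: "green \<alpha> G s v * move_prob G s v x = green \<alpha> G s v * arc_prob G v x" for v x
  proof (cases "outdeg G v = 0")
    case True
    then have "\<not> reachable (with_proj G) s v" using nd unfolding no_dead_end_def by fastforce
    then show ?thesis by (simp add: green_unreachable[OF s])
  qed (simp add: move_prob_def arc_prob_def)
  have "ppr_eq \<alpha> G s ?p"
    unfolding ppr_eq_def
  proof (intro conjI allI impI ballI)
    fix x assume x: "x \<in> pverts G"
    have "(\<Sum>v\<in>pverts G. ?p v * move_prob G s v x) = \<alpha> * (\<Sum>v\<in>pverts G. green \<alpha> G s v * arc_prob G v x)"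
      by (simp add: mult.assoc * sum_distrib_left)
    with x show "?p x = \<alpha> * of_bool (x = s) + (1 - \<alpha>) * (\<Sum>v\<in>pverts G. ?p v * move_prob G s v x)"
      by (simp add: green_eq[OF s x] algebra_simps)
  qed auto
  then have "ppr \<alpha> G s = ?p"
    unfolding ppr_def using ex1_ppr_eq[OF \<alpha> s] by (blast intro: the1_equality)
  then show "x \<in> pverts G \<Longrightarrow> ppr \<alpha> G s x = \<alpha> * green \<alpha> G s x" by simp
qed

section \<open>The weight of the potential\<close>

lemma push_weight_nonneg: "(\<And>s. s \<in> pverts G \<Longrightarrow> g s \<ge> 0) \<Longrightarrow> push_weight \<alpha> G g x \<ge> 0"
  using \<alpha> by (auto simp: push_weight_def green_nonneg intro!: sum_nonneg mult_nonneg_nonneg)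

text \<open>The equation of \<open>green\<close> is linear in the source term, so it passes to
  combinations of sources with coefficients \<open>g\<close>.\<close>

lemma push_weight_eq:
  assumes x: "x \<in> pverts G"
  shows "push_weight \<alpha> G g x = \<alpha> * g x + (1 - \<alpha>) * (\<Sum>v\<in>pverts G. push_weight \<alpha> G g v * arc_prob G v x)"
proof -
  have "push_weight \<alpha> G g x = \<alpha> * (\<Sum>s\<in>pverts G.
      g s * (of_bool (x = s) + (1 - \<alpha>) * (\<Sum>v\<in>pverts G. green \<alpha> G s v * arc_prob G v x)))"
    by (simp only: push_weight_def x if_True) (intro arg_cong2[where f = "(*)"] sum.cong refl green_eq x)
  also have "\<dots> = \<alpha> * (\<Sum>s\<in>pverts G. g s * of_bool (x = s)) + (1 - \<alpha>) * (\<Sum>s\<in>pverts G. \<Sum>v\<in>pverts G. \<alpha> * (g s * green \<alpha> G s v) * arc_prob G v x)"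
    by (simp add: distrib_left sum.distrib sum_distrib_left mult_ac del: sum_mult_of_bool_eq)
  also have "(\<Sum>s\<in>pverts G. g s * of_bool (x = s)) = (\<Sum>s\<in>{x}. g s)"
    using x pair_finite_verts by (intro sum.mono_neutral_cong_right) auto
  also have "(\<Sum>s\<in>pverts G. \<Sum>v\<in>pverts G. \<alpha> * (g s * green \<alpha> G s v) * arc_prob G v x)
     = (\<Sum>v\<in>pverts G. push_weight \<alpha> G g v * arc_prob G v x)"
    by (subst sum.swap) (simp add: push_weight_def sum_distrib_right sum_distrib_left)
  finally show ?thesis by simp
qed

text \<open>Each source spreads its cost with total mass at most \<open>1\<close>, by
  \<open>green_sum_le\<close>. For in-degree costs this bounds the total initial weight by the
  number of arcs.\<close>

lemma sum_push_weight_le: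
  assumes "\<And>s. s \<in> pverts G \<Longrightarrow> g s \<ge> 0"
  shows "(\<Sum>x\<in>pverts G. push_weight \<alpha> G g x) \<le> (\<Sum>s\<in>pverts G. g s)"
proof -
  have "(\<Sum>x\<in>pverts G. push_weight \<alpha> G g x) = (\<Sum>s\<in>pverts G. g s * (\<alpha> * (\<Sum>x\<in>pverts G. green \<alpha> G s x)))"
    by (simp add: push_weight_def sum_distrib_left mult_ac) (rule sum.swap)
  also have "\<dots> \<le> (\<Sum>s\<in>pverts G. g s)"
    by (intro sum_mono mult_left_le green_sum_le assms)
  finally show ?thesis .
qed

end

end

section \<open>Effect of pushes and arc updates\<close>

text \<open>The invariant of reverse push in local form, one equation per vertex. The correction in
  \<open>adjust\<close> is exactly the change of \<open>R u\<close> that restores it when an arc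
  leaving \<open>u\<close> is flipped.\<close>

definition balanced :: "real \<Rightarrow> 'v \<Rightarrow> 'v pair_pre_digraph \<Rightarrow> ('v \<Rightarrow> real) \<Rightarrow> ('v \<Rightarrow> real) \<Rightarrow> 'v \<Rightarrow> bool" where
  "balanced \<alpha> t G P R u \<longleftrightarrow>
     P u + \<alpha> * R u = \<alpha> * of_bool (u = t) + (1 - \<alpha>) * (\<Sum>y | (u, y) \<in> parcs G. P y) / real (outdeg G u)"

text \<open>
  The vectors at a vertex without out-neighbours are frozen from the moment it lost its last arc, so
  there \<open>P\<close> obeys an older bound \<open>B\<close>. The other alternative describes a vertex that never had an
  out-neighbour and has not been pushed yet.
\<close>
definition push_inv ::
  "real \<Rightarrow> real \<Rightarrow> 'v \<Rightarrow> 'v pair_pre_digraph \<Rightarrow> ('v \<Rightarrow> real) \<Rightarrow> ('v \<Rightarrow> real) \<Rightarrow> ('v \<Rightarrow> real) \<Rightarrow> bool" where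
  "push_inv \<alpha> \<epsilon> t G B P R \<longleftrightarrow>
     (\<forall>u. outdeg G u \<noteq> 0 \<longrightarrow> balanced \<alpha> t G P R u) \<and>
     (\<forall>u. outdeg G u = 0 \<longrightarrow> \<bar>R u\<bar> \<le> \<epsilon> \<and> \<bar>P u\<bar> \<le> B u + \<epsilon> \<or> P u = 0 \<and> R u = of_bool (u = t) \<and> of_bool (u = t) \<le> B u) \<and>
     (\<forall>u. u \<notin> pverts G \<longrightarrow> R u = 0)"

text \<open>The probability that the killed walk from \<open>u\<close> makes its \<alpha>-stop at
  \<open>t\<close>, plus the expected value of \<open>B\<close> at the dead end where it dies.
  Without dead ends this is personalized PageRank.\<close>

definition next_bound ::
  "real \<Rightarrow> 'v \<Rightarrow> 'v pair_pre_digraph \<Rightarrow> ('v \<Rightarrow> real) \<Rightarrow> 'v \<Rightarrow> real" where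
  "next_bound \<alpha> t G B u = (if outdeg G u = 0 then B u
     else \<Sum>x\<in>pverts G. green \<alpha> G u x * (if outdeg G x = 0 then B x else \<alpha> * of_bool (x = t)))"

text \<open>Distinct tails mean that every out-neighbourhood changes by at most one arc, which is
  what one correction in \<open>adjust\<close> can handle. The two orientations of an edge and a
  single arc are both covered.\<close>

definition arc_flip :: "'v pair_pre_digraph \<Rightarrow> 'v pair_pre_digraph \<Rightarrow> ('v \<times> 'v) list \<Rightarrow> bool" where
  "arc_flip G G' L \<longleftrightarrow> pverts G \<subseteq> pverts G' \<and> distinct (map fst L) \<and> fst ` set L \<subseteq> pverts G' \<and>
     (\<forall>a. a \<in> parcs G' \<longleftrightarrow> (a \<in> parcs G) \<noteq> (a \<in> set L))"

text \<open>Adjustments leave \<open>P\<close> alone and touch the residual of their own tail only.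
  As tails are distinct, each of them reads the residuals from before the whole batch.\<close>

lemma fold_adjust:
  assumes "distinct (map fst L)" and "fold (adjust \<alpha> t G) L (P, R) = (P', R')"
  shows "P' = P \<and> (\<forall>u. u \<notin> fst ` set L \<longrightarrow> R' u = R u) \<and>
    (\<forall>u v. (u, v) \<in> set L \<longrightarrow> R' u =
      (let \<delta> = ((1 - \<alpha>) * P v - P u - \<alpha> * R u + \<alpha> * of_bool (u = t)) / (\<alpha> * real (outdeg G u))
       in if (u, v) \<in> parcs G then R u + \<delta> else R u - \<delta>))"
  using assms
proof (induction L arbitrary: R)
  case (Cons a L)
  obtain x y where a: "a = (x, y)" by (cases a)
  define R1 where "R1 = R(x := let \<delta> = ((1 - \<alpha>) * P y - P x - \<alpha> * R x + \<alpha> * of_bool (x = t)) / (\<alpha> * real (outdeg G x))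
     in if (x, y) \<in> parcs G then R x + \<delta> else R x - \<delta>)"
  have "adjust \<alpha> t G a (P, R) = (P, R1)"
    by (simp add: adjust_def a Let_def R1_def)
  with Cons.prems have prems: "distinct (map fst L)" "fold (adjust \<alpha> t G) L (P, R1) = (P', R')"
    and x: "x \<notin> fst ` set L"
    by (simp_all add: a)
  note IH = Cons.IH[OF prems]
  show ?case
  proof (intro conjI allI impI)
    fix u v assume "(u, v) \<in> set (a # L)"
    then consider "u = x" "v = y" | "(u, v) \<in> set L" by (auto simp: a)
    then show "R' u = (let \<delta> = ((1 - \<alpha>) * P v - P u - \<alpha> * R u + \<alpha> * of_bool (u = t)) / (\<alpha> * real (outdeg G u))
       in if (u, v) \<in> parcs G then R u + \<delta> else R u - \<delta>)"
    proof cases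
      case 1
      then have "R' u = R1 u" using IH x by blast
      with 1 show ?thesis by (simp only: R1_def fun_upd_same)
    next
      case 2
      then have "u \<in> fst ` set L" by force
      then have "R1 u = R u" using x by (auto simp: R1_def)
      show ?thesis using IH 2 unfolding \<open>R1 u = R u\<close>[symmetric] by blast
    qed
  qed (use IH in \<open>auto simp: a R1_def\<close>)
qed simp

section \<open>Effect of a push, and what the invariant implies once the residuals are small\<close>

context pair_digraph
begin

context
  fixes \<alpha> :: real
  assumes \<alpha>: "0 < \<alpha>" "\<alpha> < 1"
begin

text \<open>Emptying \<open>u\<close> frees \<open>w u\<close> times its residual in absolute value.
  By the triangle inequality the in-neighbours gain at most what \<open>wu\<close> permits, and the
  remainder is the term with \<open>g\<close>; cancelling signs only help.\<close>

lemma rev_push_potential: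
  assumes u: "u \<in> pverts G" and w: "\<And>v. v \<in> pverts G \<Longrightarrow> w v \<ge> 0"
    and wu: "w u \<ge> \<alpha> * g + (1 - \<alpha>) * (\<Sum>v\<in>pverts G. w v * arc_prob G v u)"
  shows "(\<Sum>v\<in>pverts G. w v * \<bar>snd (rev_push \<alpha> G u S) v\<bar>)
     \<le> (\<Sum>v\<in>pverts G. w v * \<bar>snd S v\<bar>) - \<alpha> * g * \<bar>snd S u\<bar>"
proof -
  define R where "R = snd S"
  define R' where "R' = snd (rev_push \<alpha> G u S)"
  have R': "R' v = (if v = u then 0 else R v + (1 - \<alpha>) * R u * arc_prob G v u)" for v
    by (auto simp: R'_def R_def rev_push_def arc_prob_def split: prod.splits)
  have "(\<Sum>v\<in>pverts G. w v * \<bar>R' v\<bar>) \<le> (\<Sum>v\<in>pverts G. (w v * \<bar>R v\<bar> + (1 - \<alpha>) * \<bar>R u\<bar> * (w v * arc_prob G v u)) - (if v = u then w u * \<bar>R u\<bar> else 0))"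
  proof (rule sum_mono)
    fix v assume v: "v \<in> pverts G"
    have "w v * \<bar>R v + (1 - \<alpha>) * R u * arc_prob G v u\<bar> \<le> w v * (\<bar>R v\<bar> + \<bar>(1 - \<alpha>) * R u * arc_prob G v u\<bar>)"
      by (intro mult_left_mono abs_triangle_ineq w v)
    also have "\<dots> = w v * \<bar>R v\<bar> + (1 - \<alpha>) * \<bar>R u\<bar> * (w v * arc_prob G v u)"
    proof -
      have "\<bar>(1 - \<alpha>) * R u * arc_prob G v u\<bar> = (1 - \<alpha>) * \<bar>R u\<bar> * arc_prob G v u"
        using \<alpha> by (simp add: abs_mult arc_prob_nonneg)
      then show ?thesis by (simp only: distrib_left mult_ac)
    qed
    finally show "w v * \<bar>R' v\<bar> \<le> (w v * \<bar>R v\<bar> + (1 - \<alpha>) * \<bar>R u\<bar> * (w v * arc_prob G v u)) - (if v = u then w u * \<bar>R u\<bar> else 0)"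
      by (auto simp: R' arc_prob_loop)
  qed
  also have "\<dots> = (\<Sum>v\<in>pverts G. w v * \<bar>R v\<bar>) + \<bar>R u\<bar> * ((1 - \<alpha>) * (\<Sum>v\<in>pverts G. w v * arc_prob G v u) - w u)"
    using u pair_finite_verts
    by (simp add: sum.distrib sum_subtractf sum.delta algebra_simps sum_distrib_left)
  also have "\<dots> \<le> (\<Sum>v\<in>pverts G. w v * \<bar>R v\<bar>) + \<bar>R u\<bar> * (- \<alpha> * g)"
    using wu by (intro add_left_mono mult_left_mono) auto
  finally show ?thesis by (simp add: R_def R'_def mult_ac)
qed

text \<open>Moving \<alpha> times \<open>R u\<close> into \<open>P u\<close> raises the right-hand
  side of \<open>balanced\<close> at each in-neighbour by exactly \<alpha> times the residual it
  receives, and leaves the left-hand side at \<open>u\<close> unchanged.\<close>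

lemma push_inv_rev_push:
  assumes inv: "push_inv \<alpha> \<epsilon> t G B P R" and u: "u \<in> pverts G" and Ru: "\<bar>R u\<bar> > \<epsilon>" and \<epsilon>: "\<epsilon> > 0"
    and upd: "rev_push \<alpha> G u (P, R) = (P', R')"
  shows "push_inv \<alpha> \<epsilon> t G B P' R'"
proof -
  have P': "P' x = (if x = u then P u + \<alpha> * R u else P x)"
    and R': "R' x = (if x = u then 0 else R x + of_bool ((x, u) \<in> parcs G) * ((1 - \<alpha>) * R u / real (outdeg G x)))" for x
    using upd by (auto simp: rev_push_def simp del: times_divide_eq_right)
  show ?thesis
    unfolding push_inv_def
  proof (intro conjI allI impI)
    fix x assume x: "outdeg G x \<noteq> 0"
    have "balanced \<alpha> t G P R x" using inv x by (simp add: push_inv_def)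
    moreover have "(\<Sum>y | (x, y) \<in> parcs G. P' y) = (\<Sum>y | (x, y) \<in> parcs G. P y) + of_bool ((x, u) \<in> parcs G) * (\<alpha> * R u)"
    proof -
      have "(\<Sum>y | (x, y) \<in> parcs G. P' y) = (\<Sum>y | (x, y) \<in> parcs G. P y + (if y = u then \<alpha> * R u else 0))"
        by (intro sum.cong) (auto simp: P')
      also have "\<dots> = (\<Sum>y | (x, y) \<in> parcs G. P y) + of_bool ((x, u) \<in> parcs G) * (\<alpha> * R u)"
        using finite_out by (simp add: sum.distrib sum.delta)
      finally show ?thesis .
    qed
    moreover have "P' x + \<alpha> * R' x
        = P x + \<alpha> * R x + (1 - \<alpha>) * (of_bool ((x, u) \<in> parcs G) * (\<alpha> * R u)) / real (outdeg G x)"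
      using no_loops'[of u u] by (cases "x = u") (auto simp: P' R' algebra_simps)
    ultimately show "balanced \<alpha> t G P' R' x"
      unfolding balanced_def by (simp only: distrib_left add_divide_distrib add.assoc)
  next
    fix x assume x: "outdeg G x = 0"
    have "(x, u) \<notin> parcs G" using outdeg_pos[of x u] x by auto
    have dead: "\<bar>R x\<bar> \<le> \<epsilon> \<and> \<bar>P x\<bar> \<le> B x + \<epsilon> \<or> P x = 0 \<and> R x = of_bool (x = t) \<and> of_bool (x = t) \<le> B x"
      using inv x by (simp add: push_inv_def)
    show "\<bar>R' x\<bar> \<le> \<epsilon> \<and> \<bar>P' x\<bar> \<le> B x + \<epsilon> \<or> P' x = 0 \<and> R' x = of_bool (x = t) \<and> of_bool (x = t) \<le> B x"
    proof (cases "x = u")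
      case True
      \<comment> \<open>A dead end with a large residual can only be an untouched vertex. If it is
        the target, the push turns residual \<open>1\<close> into the estimate \<alpha>, which is
        below \<open>B x\<close> since \<open>B x\<close> is at least \<open>1\<close>.\<close>
      with dead Ru have "P x = 0" "R x = of_bool (x = t)" "of_bool (x = t) \<le> B x" by auto
      with True \<open>\<epsilon> > 0\<close> \<alpha> show ?thesis by (cases "x = t") (simp_all add: P' R')
    next
      case False
      with dead \<open>(x, u) \<notin> parcs G\<close> show ?thesis by (simp add: P' R')
    qed
  next
    fix x assume x: "x \<notin> pverts G"
    then show "R' x = 0"
      using inv u in_arcsD1 by (auto simp: R' push_inv_def)
  qed
qed

lemma balanced_defect:
  assumes "balanced \<alpha> t G P R x"
  shows "P x - (1 - \<alpha>) * (\<Sum>y\<in>pverts G. arc_prob G x y * P y) = \<alpha> * of_bool (x = t) - \<alpha> * R x"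
proof -
  have "(\<Sum>y\<in>pverts G. arc_prob G x y * P y) = (\<Sum>y\<in>pverts G. of_bool ((x, y) \<in> parcs G) * (P y / real (outdeg G x)))"
    by (simp add: arc_prob_def)
  also have "\<dots> = (\<Sum>y | (x, y) \<in> parcs G. P y) / real (outdeg G x)"
    unfolding sum_out by (simp add: sum_divide_distrib)
  finally show ?thesis using assms by (simp add: balanced_def)
qed

text \<open>By \<open>green_inverse\<close>, \<open>P s\<close> is the PageRank value minus \<alpha>
  times the sum of the residuals weighted by \<open>green\<close>. Vertices carrying Green mass are
  reachable, hence balanced, and the weights of the error sum to at most \<open>1\<close>.\<close>

lemma push_inv_accurate:
  assumes inv: "push_inv \<alpha> \<epsilon> t G B P R" and R: "\<And>u. u \<in> pverts G \<Longrightarrow> \<bar>R u\<bar> \<le> \<epsilon>"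
    and s: "s \<in> pverts G" and t: "t \<in> pverts G" and nd: "no_dead_end G s"
  shows "\<bar>P s - ppr \<alpha> G s t\<bar> \<le> \<epsilon>"
proof -
  have "P s = (\<Sum>x\<in>pverts G. green \<alpha> G s x * (P x - (1 - \<alpha>) * (\<Sum>y\<in>pverts G. arc_prob G x y * P y)))"
    by (rule green_inverse[OF \<alpha> s])
  also have "\<dots> = (\<Sum>x\<in>pverts G. green \<alpha> G s x * (\<alpha> * of_bool (x = t) - \<alpha> * R x))"
  proof (intro sum.cong refl)
    fix x
    show "green \<alpha> G s x * (P x - (1 - \<alpha>) * (\<Sum>y\<in>pverts G. arc_prob G x y * P y)) = green \<alpha> G s x * (\<alpha> * of_bool (x = t) - \<alpha> * R x)"
    proof (cases "reachable (with_proj G) s x")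
      case True
      then have "outdeg G x \<noteq> 0" using nd unfolding no_dead_end_def by fastforce
      then show ?thesis using inv by (simp add: push_inv_def balanced_defect)
    qed (simp add: green_unreachable[OF \<alpha> s])
  qed
  also have "\<dots> = (\<Sum>x\<in>pverts G. of_bool (x = t) * (\<alpha> * green \<alpha> G s x)) - \<alpha> * (\<Sum>x\<in>pverts G. green \<alpha> G s x * R x)"
    by (simp only: right_diff_distrib sum_subtractf sum_distrib_left mult_ac)
  also have "(\<Sum>x\<in>pverts G. of_bool (x = t) * (\<alpha> * green \<alpha> G s x)) = (\<Sum>x\<in>{t}. \<alpha> * green \<alpha> G s x)"
    using t pair_finite_verts by (intro sum.mono_neutral_cong_right) auto
  finally have "\<bar>P s - ppr \<alpha> G s t\<bar> = \<alpha> * \<bar>\<Sum>x\<in>pverts G. green \<alpha> G s x * R x\<bar>"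
    using \<alpha> by (simp add: ppr_eq_green[OF \<alpha> s nd t] abs_mult)
  also have "\<dots> \<le> \<alpha> * (\<Sum>x\<in>pverts G. green \<alpha> G s x * \<epsilon>)"
    using \<alpha> R green_nonneg[OF \<alpha> s]
    by (intro mult_left_mono order_trans[OF sum_abs] sum_mono) (auto simp: abs_mult intro!: mult_left_mono)
  also have "\<dots> = \<epsilon> * (\<alpha> * (\<Sum>x\<in>pverts G. green \<alpha> G s x))"
    by (simp flip: sum_distrib_right)
  also have "\<dots> \<le> \<epsilon>"
    using green_sum_le[OF \<alpha> s] R[OF s] by (intro mult_left_le) auto
  finally show ?thesis .
qed

text \<open>The same inversion with dead ends allowed. The error terms carry weight \<open>1\<close>
  at dead ends and \<alpha> elsewhere, so by \<open>green_mass\<close> they add up to exactly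
  \<epsilon>: the slack does not accumulate over updates.\<close>

lemma push_inv_bound:
  assumes inv: "push_inv \<alpha> \<epsilon> t G B P R" and R: "\<And>u. u \<in> pverts G \<Longrightarrow> \<bar>R u\<bar> \<le> \<epsilon>"
    and \<epsilon>: "\<epsilon> > 0"
  shows "\<bar>P u\<bar> \<le> next_bound \<alpha> t G B u + \<epsilon>"
proof -
  \<comment> \<open>For an untouched dead end, \<open>P x\<close> is \<open>0\<close> and the
    indicator bound makes \<open>B x\<close> nonnegative.\<close>
  have dead: "\<bar>P x\<bar> \<le> B x + \<epsilon>" if "outdeg G x = 0" for x
    using inv that \<epsilon> unfolding push_inv_def by (cases "x = t") force+
  show ?thesis
  proof (cases "outdeg G u = 0")
    case True
    then show ?thesis by (simp add: next_bound_def dead)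
  next
    case False
    then have u: "u \<in> pverts G" by (metis outdeg_outside)
    let ?c = "\<lambda>x. if outdeg G x = 0 then B x else \<alpha> * of_bool (x = t)"
    have le: "\<bar>P x - (1 - \<alpha>) * (\<Sum>y\<in>pverts G. arc_prob G x y * P y)\<bar> \<le> ?c x + \<epsilon> * (if outdeg G x = 0 then 1 else \<alpha>)"
      if x: "x \<in> pverts G" for x
    proof (cases "outdeg G x = 0")
      case True
      then have "arc_prob G x y = 0" for y by (simp add: arc_prob_def)
      then show ?thesis using dead[OF True] True by simp
    next
      case False
      then have "balanced \<alpha> t G P R x" using inv by (simp add: push_inv_def)
      note defect = balanced_defect[OF this]
      have "\<bar>\<alpha> * of_bool (x = t) - \<alpha> * R x\<bar> \<le> \<alpha> * of_bool (x = t) + \<alpha> * \<bar>R x\<bar>"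
        using \<alpha> abs_triangle_ineq4[of "\<alpha> * of_bool (x = t)" "\<alpha> * R x"] by (simp add: abs_mult)
      also have "\<dots> \<le> \<alpha> * of_bool (x = t) + \<epsilon> * \<alpha>"
        using \<alpha> R[OF x] by (simp add: mult.commute[of \<epsilon>])
      finally show ?thesis using False unfolding defect by simp
    qed
    have "\<bar>P u\<bar> = \<bar>\<Sum>x\<in>pverts G. green \<alpha> G u x * (P x - (1 - \<alpha>) * (\<Sum>y\<in>pverts G. arc_prob G x y * P y))\<bar>"
      using green_inverse[OF \<alpha> u, of P] by simp
    also have "\<dots> \<le> (\<Sum>x\<in>pverts G. green \<alpha> G u x * (?c x + \<epsilon> * (if outdeg G x = 0 then 1 else \<alpha>)))"
      by (intro order_trans[OF sum_abs] sum_mono)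
        (use le green_nonneg[OF \<alpha> u] in \<open>auto simp only: abs_mult abs_of_nonneg intro!: mult_left_mono\<close>)
    also have "\<dots> = next_bound \<alpha> t G B u + \<epsilon> * (\<Sum>x\<in>pverts G. green \<alpha> G u x * (if outdeg G x = 0 then 1 else \<alpha>))"
      using False unfolding next_bound_def by (simp only: if_False distrib_left sum.distrib sum_distrib_left mult_ac)
    finally show ?thesis using green_mass[OF \<alpha> u] by simp
  qed
qed

lemma next_bound_nonneg:
  assumes "\<And>x. B x \<ge> 0"
  shows "next_bound \<alpha> t G B u \<ge> 0"
proof (cases "u \<in> pverts G")
  case True
  then show ?thesis using \<alpha> assms green_nonneg[OF \<alpha> True] 
    by (auto simp: next_bound_def intro!: sum_nonneg mult_nonneg_nonneg)
qed (use assms outdeg_outside in \<open>simp add: next_bound_def\<close>)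

text \<open>The payoffs of all targets together are at most \<open>1\<close> where the walk dies and
  \<alpha> where it may stop, so \<open>green_mass\<close> bounds the total. Hence the bound is at
  most \<open>1/n\<close> on average over a random target.\<close>

lemma sum_next_bound:
  assumes B: "\<And>x. (\<Sum>t\<in>T. B t x) \<le> 1" and T: "finite T"
  shows "(\<Sum>t\<in>T. next_bound \<alpha> t G (B t) u) \<le> 1"
proof (cases "outdeg G u = 0")
  case False
  then have u: "u \<in> pverts G" by (metis outdeg_outside)
  have "(\<Sum>t\<in>T. next_bound \<alpha> t G (B t) u)
     = (\<Sum>x\<in>pverts G. green \<alpha> G u x * (\<Sum>t\<in>T. if outdeg G x = 0 then B t x else \<alpha> * of_bool (x = t)))"
    using False by (simp only: next_bound_def if_False sum_distrib_left) (rule sum.swap)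
  also have "\<dots> \<le> (\<Sum>x\<in>pverts G. green \<alpha> G u x * (if outdeg G x = 0 then 1 else \<alpha>))"
  proof (intro sum_mono mult_left_mono green_nonneg \<alpha> u)
    fix x
    have "(\<Sum>t\<in>T. of_bool (x = t) :: real) \<le> 1"
      using T by (simp add: of_bool_def sum.delta')
    then have "\<alpha> * (\<Sum>t\<in>T. of_bool (x = t)) \<le> \<alpha>" using \<alpha> by (intro mult_left_le) auto
    then show "(\<Sum>t\<in>T. if outdeg G x = 0 then B t x else \<alpha> * of_bool (x = t)) \<le> (if outdeg G x = 0 then 1 else \<alpha>)"
      using B[of x] by (simp only: sum_distrib_left split: if_split) simp
  qed
  finally show ?thesis using green_mass[OF \<alpha> u] by simp
qed (simp add: next_bound_def B)

end

end

section \<open>Restoring the invariant after an update\<close>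

lemma insert_balance:
  fixes d :: real
  assumes "\<alpha> > 0" "d \<ge> 0" and "d \<noteq> 0 \<Longrightarrow> P + \<alpha> * R = c + (1 - \<alpha>) * S / d" and "d = 0 \<Longrightarrow> S = 0"
  shows "P + \<alpha> * (R + ((1 - \<alpha>) * p - P - \<alpha> * R + c) / (\<alpha> * (d + 1))) = c + (1 - \<alpha>) * (S + p) / (d + 1)"
proof -
  \<comment> \<open>Clearing the old degree \<open>d\<close> also covers the first arc out of a
    vertex: for \<open>d = 0\<close> the old balance is void and \<open>S = 0\<close> takes its
    place.\<close>
  have "d * (P + \<alpha> * R) = d * c + (1 - \<alpha>) * S"
    using assms(3,4) by (cases "d = 0") (auto simp: field_simps)
  moreover have "\<alpha> * (((1 - \<alpha>) * p - P - \<alpha> * R + c) / (\<alpha> * (d + 1))) = ((1 - \<alpha>) * p - P - \<alpha> * R + c) / (d + 1)"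
    using assms(1) by simp
  moreover have "d + 1 > 0" using assms(2) by simp
  ultimately show ?thesis unfolding distrib_left[of \<alpha>] by (simp add: field_simps)
qed

text \<open>Here \<open>d\<close> is the new degree; its positivity excludes the deletion of the
  last arc, after which no balance is claimed.\<close>

lemma delete_balance:
  fixes d :: real
  assumes "\<alpha> > 0" "d > 0" and "P + \<alpha> * R = c + (1 - \<alpha>) * (S + p) / (d + 1)"
  shows "P + \<alpha> * (R - ((1 - \<alpha>) * p - P - \<alpha> * R + c) / (\<alpha> * d)) = c + (1 - \<alpha>) * S / d"
proof -
  have "(d + 1) * (P + \<alpha> * R) = (d + 1) * c + (1 - \<alpha>) * (S + p)"
    using assms(2,3) by (simp add: field_simps)
  moreover have "\<alpha> * (((1 - \<alpha>) * p - P - \<alpha> * R + c) / (\<alpha> * d)) = ((1 - \<alpha>) * p - P - \<alpha> * R + c) / d"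
    using assms(1) by simp
  ultimately show ?thesis unfolding right_diff_distrib[of \<alpha>] using assms(2) by (simp add: field_simps)
qed

lemma arc_flip_out:
  assumes "arc_flip G G' L"
  shows "u \<notin> fst ` set L \<Longrightarrow> {y. (u, y) \<in> parcs G'} = {y. (u, y) \<in> parcs G}"
    and "(u, v) \<in> set L \<Longrightarrow> (u, v) \<in> parcs G' \<Longrightarrow>
      v \<notin> {y. (u, y) \<in> parcs G} \<and> {y. (u, y) \<in> parcs G'} = insert v {y. (u, y) \<in> parcs G}"
    and "(u, v) \<in> set L \<Longrightarrow> (u, v) \<notin> parcs G' \<Longrightarrow>
      v \<notin> {y. (u, y) \<in> parcs G'} \<and> {y. (u, y) \<in> parcs G} = insert v {y. (u, y) \<in> parcs G'}"
proof -
  have eq: "(x, y) \<in> parcs G' \<longleftrightarrow> ((x, y) \<in> parcs G) \<noteq> ((x, y) \<in> set L)" for x y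
    using assms by (simp add: arc_flip_def)
  have uniq: "y = v" if "(u, y) \<in> set L" "(u, v) \<in> set L" for u y v
    using assms that inj_onD[of fst "set L" "(u, y)" "(u, v)"] by (simp add: arc_flip_def distinct_map)
  show "u \<notin> fst ` set L \<Longrightarrow> {y. (u, y) \<in> parcs G'} = {y. (u, y) \<in> parcs G}"
    by (force simp: eq)
  show "(u, v) \<in> set L \<Longrightarrow> (u, v) \<in> parcs G' \<Longrightarrow>
      v \<notin> {y. (u, y) \<in> parcs G} \<and> {y. (u, y) \<in> parcs G'} = insert v {y. (u, y) \<in> parcs G}"
    using uniq by (auto simp: eq)
  show "(u, v) \<in> set L \<Longrightarrow> (u, v) \<notin> parcs G' \<Longrightarrow>
      v \<notin> {y. (u, y) \<in> parcs G'} \<and> {y. (u, y) \<in> parcs G} = insert v {y. (u, y) \<in> parcs G'}"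
    using uniq by (auto simp: eq)
qed

context
  fixes \<alpha> \<epsilon> :: real and t :: 'v and G G' :: "'v pair_pre_digraph" and L B P R P' R'
  assumes \<alpha>: "0 < \<alpha>" "\<alpha> < 1" and \<epsilon>: "\<epsilon> > 0"
    and G: "pair_digraph G" and G': "pair_digraph G'" and flip: "arc_flip G G' L"
    and inv: "push_inv \<alpha> \<epsilon> t G B P R" and R: "\<And>u. u \<in> pverts G \<Longrightarrow> \<bar>R u\<bar> \<le> \<epsilon>"
    and upd: "fold (adjust \<alpha> t G') L (P, R) = (P', R')"
begin

lemma flip_residual:
  shows flip_P: "P' = P" and flip_R_other: "u \<notin> fst ` set L \<Longrightarrow> R' u = R u"
    and flip_R: "(u, v) \<in> set L \<Longrightarrow> R' u =
      (let \<delta> = ((1 - \<alpha>) * P v - P u - \<alpha> * R u + \<alpha> * of_bool (u = t)) / (\<alpha> * real (outdeg G' u))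
       in if (u, v) \<in> parcs G' then R u + \<delta> else R u - \<delta>)"
  using fold_adjust[OF _ upd] flip unfolding arc_flip_def by blast+

lemma residual_le: "\<bar>R u\<bar> \<le> \<epsilon>"
  using R[of u] inv \<epsilon> by (cases "u \<in> pverts G") (auto simp: push_inv_def)

lemma flip_balanced:
  assumes u: "outdeg G' u \<noteq> 0"
  shows "balanced \<alpha> t G' P R' u"
proof (cases "u \<in> fst ` set L")
  case False
  note out = arc_flip_out(1)[OF flip False]
  then have "outdeg G' u = outdeg G u" by (simp add: outdeg_eq_card)
  with u inv have "balanced \<alpha> t G P R u" by (simp add: push_inv_def)
  then show ?thesis
    by (simp add: balanced_def out flip_R_other[OF False] \<open>outdeg G' u = outdeg G u\<close>)
next
  case True
  then obtain v where L: "(u, v) \<in> set L" by force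
  let ?N = "{y. (u, y) \<in> parcs G}" and ?N' = "{y. (u, y) \<in> parcs G'}"
  have fin: "finite ?N" "finite ?N'"
    using G G' by (auto intro: pair_digraph.finite_out)
  have bal: "balanced \<alpha> t G P R u" if "outdeg G u \<noteq> 0"
    using that inv by (simp add: push_inv_def)
  show ?thesis
  proof (cases "(u, v) \<in> parcs G'")
    case True
    note out = arc_flip_out(2)[OF flip L True]
    have d: "real (outdeg G' u) = real (outdeg G u) + 1"
      using out fin by (simp add: outdeg_eq_card)
    have S: "sum P ?N' = sum P ?N + P v"
      using out fin by simp
    have "outdeg G u = 0 \<Longrightarrow> sum P ?N = 0" using fin by (simp add: outdeg_eq_card)
    then show ?thesis
      unfolding balanced_def flip_R[OF L] Let_def if_P[OF True] S d
      by (intro insert_balance) (use \<alpha> bal in \<open>auto simp: balanced_def\<close>)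
  next
    case False
    note out = arc_flip_out(3)[OF flip L False]
    have d: "real (outdeg G u) = real (outdeg G' u) + 1"
      using out fin by (simp add: outdeg_eq_card)
    have S: "sum P ?N = sum P ?N' + P v"
      using out fin by simp
    have "outdeg G u \<noteq> 0" using d by auto
    from bal[OF this] u show ?thesis
      unfolding balanced_def flip_R[OF L] Let_def if_not_P[OF False] S d
      by (intro delete_balance) (use \<alpha> in auto)
  qed
qed

text \<open>At a dead end of the new graph the correction divides by zero and leaves the residual
  alone, so it is still at most \<epsilon>. The bound on \<open>P\<close> is the one reached on the
  old graph, which is why \<open>B\<close> advances to \<open>next_bound\<close>.\<close>

lemma push_inv_flip: "push_inv \<alpha> \<epsilon> t G' (next_bound \<alpha> t G B) P' R'"
  unfolding push_inv_def flip_P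
proof (intro conjI allI impI)
  fix u assume "outdeg G' u \<noteq> 0"
  then show "balanced \<alpha> t G' P R' u" by (rule flip_balanced)
next
  fix u assume u: "outdeg G' u = 0"
  have "R' u = R u"
  proof (cases "u \<in> fst ` set L")
    case True
    then obtain v where L: "(u, v) \<in> set L" by force
    show ?thesis unfolding flip_R[OF L] using u by simp
  qed (simp add: flip_R_other)
  then show "\<bar>R' u\<bar> \<le> \<epsilon> \<and> \<bar>P u\<bar> \<le> next_bound \<alpha> t G B u + \<epsilon>
      \<or> P u = 0 \<and> R' u = of_bool (u = t) \<and> of_bool (u = t) \<le> next_bound \<alpha> t G B u"
    using residual_le[of u] pair_digraph.push_inv_bound[OF G \<alpha> inv R \<epsilon>] by simp
next
  fix u assume u: "u \<notin> pverts G'"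
  then have "u \<notin> fst ` set L" "u \<notin> pverts G" using flip by (auto simp: arc_flip_def)
  then show "R' u = 0" using inv by (simp add: push_inv_def flip_R_other)
qed

text \<open>The three \<epsilon> are the slack of the bounds on \<open>P u\<close> and
  \<open>P v\<close> and the size of \<open>R u\<close>.\<close>

lemma flip_residual_change:
  assumes L: "(u, v) \<in> set L"
  shows "\<bar>R' u - R u\<bar> \<le>
    (next_bound \<alpha> t G B u + next_bound \<alpha> t G B v + 3 * \<epsilon> + of_bool (u = t)) / \<alpha> / real (outdeg G' u)"
proof -
  let ?x = "(1 - \<alpha>) * P v - P u - \<alpha> * R u + \<alpha> * of_bool (u = t)"
  note bound = pair_digraph.push_inv_bound[OF G \<alpha> inv R \<epsilon>]
  have 1: "(1 - \<alpha>) * \<bar>P v\<bar> \<le> 1 * \<bar>P v\<bar>" and 2: "\<alpha> * \<bar>R u\<bar> \<le> 1 * \<bar>R u\<bar>"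
    and 3: "\<alpha> * of_bool (u = t) \<le> 1 * of_bool (u = t)"
    using \<alpha> by (intro mult_right_mono; simp)+
  have "\<bar>?x\<bar> \<le> \<bar>(1 - \<alpha>) * P v\<bar> + \<bar>P u\<bar> + \<bar>\<alpha> * R u\<bar> + \<bar>\<alpha> * of_bool (u = t)\<bar>" by linarith
  also have "\<dots> = (1 - \<alpha>) * \<bar>P v\<bar> + \<bar>P u\<bar> + \<alpha> * \<bar>R u\<bar> + \<alpha> * of_bool (u = t)"
    using \<alpha> by (simp add: abs_mult)
  also have "\<dots> \<le> next_bound \<alpha> t G B u + next_bound \<alpha> t G B v + 3 * \<epsilon> + of_bool (u = t)"
    using 1 2 3 bound[of u] bound[of v] residual_le[of u] by linarith
  finally have x: "\<bar>?x\<bar> \<le> next_bound \<alpha> t G B u + next_bound \<alpha> t G B v + 3 * \<epsilon> + of_bool (u = t)" .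
  have "\<bar>R' u - R u\<bar> = \<bar>?x / (\<alpha> * real (outdeg G' u))\<bar>"
    unfolding flip_R[OF L] Let_def by simp
  also have "\<dots> = \<bar>?x\<bar> / (\<alpha> * real (outdeg G' u))"
    using \<alpha> by (simp add: abs_divide abs_mult)
  also have "\<dots> \<le> (next_bound \<alpha> t G B u + next_bound \<alpha> t G B v + 3 * \<epsilon> + of_bool (u = t)) / (\<alpha> * real (outdeg G' u))"
    using \<alpha> x by (intro divide_right_mono) auto
  finally show ?thesis by simp
qed

lemma flip_potential:
  assumes w: "\<And>u. w u \<ge> 0" and w0: "\<And>u. u \<notin> pverts G \<Longrightarrow> w u = 0" and w': "\<And>u. w' u \<ge> 0"
  shows "(\<Sum>u\<in>pverts G'. w' u * \<bar>R' u\<bar>) \<le> (\<Sum>u\<in>pverts G. w u * \<bar>R u\<bar>)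
    + (\<Sum>(u, v)\<in>set L. w' u / real (outdeg G' u) *
        ((next_bound \<alpha> t G B u + next_bound \<alpha> t G B v + 3 * \<epsilon> + of_bool (u = t)) / \<alpha>))
    + \<epsilon> * (\<Sum>u\<in>pverts G'. max 0 (w' u - w u))"
proof -
  interpret G': pair_digraph G' by (rule G')
  have fin: "finite (pverts G')" by (rule G'.pair_finite_verts)
  have sub: "pverts G \<subseteq> pverts G'" "fst ` set L \<subseteq> pverts G'" and dist: "distinct (map fst L)"
    using flip by (auto simp: arc_flip_def)
  \<comment> \<open>The change of the weighted residual splits into a change of the residual, paid
    at the new weight, and a change of the weight, paid on an old residual of size at most
    \<epsilon>. Only growth of the weight counts.\<close>
  have pointwise: "w' u * \<bar>R' u\<bar> \<le> w u * \<bar>R u\<bar> + w' u * \<bar>R' u - R u\<bar> + \<epsilon> * max 0 (w' u - w u)" for u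
  proof -
    have "w' u * \<bar>R' u\<bar> \<le> w' u * (\<bar>R u\<bar> + \<bar>R' u - R u\<bar>)"
      using w' by (intro mult_left_mono) auto
    moreover have "(w' u - w u) * \<bar>R u\<bar> \<le> max 0 (w' u - w u) * \<epsilon>"
      using residual_le[of u] by (intro mult_mono) auto
    ultimately show ?thesis by (simp add: algebra_simps)
  qed
  have "(\<Sum>u\<in>pverts G'. w' u * \<bar>R' u - R u\<bar>) = (\<Sum>u\<in>fst ` set L. w' u * \<bar>R' u - R u\<bar>)"
    using fin sub flip_R_other by (intro sum.mono_neutral_right) auto
  also have "\<dots> = (\<Sum>a\<in>set L. w' (fst a) * \<bar>R' (fst a) - R (fst a)\<bar>)"
    using dist by (subst sum.reindex) (auto simp: distinct_map)
  also have "\<dots> \<le> (\<Sum>(u, v)\<in>set L. w' u / real (outdeg G' u) *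
        ((next_bound \<alpha> t G B u + next_bound \<alpha> t G B v + 3 * \<epsilon> + of_bool (u = t)) / \<alpha>))"
  proof (rule sum_mono, clarify)
    fix u v assume "(u, v) \<in> set L"
    from mult_left_mono[OF flip_residual_change[OF this] w'[of u]]
    show "w' (fst (u, v)) * \<bar>R' (fst (u, v)) - R (fst (u, v))\<bar> \<le> w' u / real (outdeg G' u) *
        ((next_bound \<alpha> t G B u + next_bound \<alpha> t G B v + 3 * \<epsilon> + of_bool (u = t)) / \<alpha>)"
      by (simp add: mult_ac)
  qed
  moreover have "(\<Sum>u\<in>pverts G'. w u * \<bar>R u\<bar>) = (\<Sum>u\<in>pverts G. w u * \<bar>R u\<bar>)"
    using fin sub w0 by (intro sum.mono_neutral_right) auto
  moreover have "(\<Sum>u\<in>pverts G'. w' u * \<bar>R' u\<bar>)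
     \<le> (\<Sum>u\<in>pverts G'. w u * \<bar>R u\<bar> + w' u * \<bar>R' u - R u\<bar> + \<epsilon> * max 0 (w' u - w u))"
    by (rule sum_mono) (rule pointwise)
  ultimately show ?thesis by (simp add: sum.distrib sum_distrib_left)
qed

end

section \<open>Executions\<close>

locale dynamic_graph =
  fixes \<alpha> \<epsilon> :: real and G :: "nat \<Rightarrow> 'v pair_pre_digraph" and upd :: "nat \<Rightarrow> ('v \<times> 'v) list" and k :: nat
  assumes \<alpha>: "0 < \<alpha>" "\<alpha> < 1" and \<epsilon>: "\<epsilon> > 0"
    and digraph: "i \<le> k \<Longrightarrow> pair_digraph (G i)"
    and flip: "i < k \<Longrightarrow> arc_flip (G i) (G (Suc i)) (upd (Suc i))"
begin

text \<open>Depends on the graphs alone and not on the pushes chosen. The start value is the initial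
  residual, as the invariant demands of vertices that have not been pushed.\<close>

primrec reach_bound :: "'v \<Rightarrow> nat \<Rightarrow> 'v \<Rightarrow> real" where
  "reach_bound t 0 = (\<lambda>u. of_bool (u = t))"
| "reach_bound t (Suc i) = next_bound \<alpha> t (G i) (reach_bound t i)"

lemma reach_bound_nonneg: "i \<le> Suc k \<Longrightarrow> reach_bound t i u \<ge> 0"
proof (induction i arbitrary: u)
  case (Suc i)
  then show ?case using pair_digraph.next_bound_nonneg[OF digraph \<alpha>] by simp
qed simp

lemma sum_reach_bound: "finite T \<Longrightarrow> i \<le> Suc k \<Longrightarrow> (\<Sum>t\<in>T. reach_bound t i u) \<le> 1"
proof (induction i arbitrary: u)
  case 0
  then show ?case by (simp add: of_bool_def sum.delta')
next
  case (Suc i)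
  then show ?case using pair_digraph.sum_next_bound[OF digraph \<alpha>] by simp
qed

definition config_inv :: "'v \<Rightarrow> 'v config \<Rightarrow> bool" where
  "config_inv t = (\<lambda>(i, ph, P, R). i \<le> k \<and> push_inv \<alpha> \<epsilon> t (G i) (reach_bound t i) P R \<and>
     (ph = Negative \<longrightarrow> (\<forall>u\<in>pverts (G i). R u \<le> \<epsilon>)))"

lemma pverts_mono: "i \<le> k \<Longrightarrow> pverts (G 0) \<subseteq> pverts (G i)"
proof (induction i)
  case (Suc i)
  then show ?case using flip[of i] by (auto simp: arc_flip_def)
qed simp

lemma config_inv_init: "t \<in> pverts (G 0) \<Longrightarrow> config_inv t (init_config t)"
  by (auto simp: config_inv_def init_config_def push_inv_def balanced_def)

lemma config_inv_step:
  assumes "push_step \<alpha> \<epsilon> t G upd k x c y" "config_inv t x"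
  shows "config_inv t y"
  using assms
proof cases
  case (push_pos u i S)
  obtain P R P' R' where S: "S = (P, R)" "rev_push \<alpha> (G i) u S = (P', R')" by (cases S, cases "rev_push \<alpha> (G i) u S") auto
  have "i \<le> k" "push_inv \<alpha> \<epsilon> t (G i) (reach_bound t i) P R"
    using assms(2) push_pos S by (auto simp: config_inv_def)
  note inv = this
  have "\<bar>R u\<bar> > \<epsilon>" using push_pos S by simp
  from pair_digraph.push_inv_rev_push[OF digraph[OF inv(1)] \<alpha> inv(2) \<open>u \<in> pverts (G i)\<close> this \<epsilon>] S inv(1)
  show ?thesis unfolding push_pos(3) by (simp add: config_inv_def)
next
  case (to_neg i S)
  then show ?thesis using assms(2) by (auto simp: config_inv_def)
next
  case (push_neg u i S)
  obtain P R P' R' where S: "S = (P, R)" "rev_push \<alpha> (G i) u S = (P', R')" by (cases S, cases "rev_push \<alpha> (G i) u S") auto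
  have *: "i \<le> k" "push_inv \<alpha> \<epsilon> t (G i) (reach_bound t i) P R" and le: "\<forall>u\<in>pverts (G i). R u \<le> \<epsilon>"
    using assms(2) push_neg S by (auto simp: config_inv_def)
  have Ru: "\<bar>R u\<bar> > \<epsilon>" "R u \<le> 0" using push_neg S \<epsilon> by auto
  \<comment> \<open>The second loop cannot undo the first: pushing a negative residual only lowers
    other residuals and resets its own to \<open>0\<close>.\<close>
  have "R' v \<le> \<epsilon>" if v: "v \<in> pverts (G i)" for v
  proof (cases "v = u")
    case False
    have "(1 - \<alpha>) * R u / real (outdeg (G i) v) \<le> 0"
      using \<alpha> Ru by (intro divide_nonpos_nonneg mult_nonneg_nonpos) auto
    moreover have "R' v = R v + of_bool ((v, u) \<in> parcs (G i)) * ((1 - \<alpha>) * R u / real (outdeg (G i) v))"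
      using S False by (auto simp: rev_push_def)
    ultimately show ?thesis using le v by (cases "(v, u) \<in> parcs (G i)") force+
  qed (use S \<epsilon> in \<open>auto simp: rev_push_def\<close>)
  with pair_digraph.push_inv_rev_push[OF digraph[OF *(1)] \<alpha> *(2) \<open>u \<in> pverts (G i)\<close> Ru(1) \<epsilon>] S *(1)
  show ?thesis unfolding push_neg(3) by (simp add: config_inv_def)
next
  case (update i S)
  obtain P R P' R' where S: "S = (P, R)" "fold (adjust \<alpha> t (G (Suc i))) (upd (Suc i)) S = (P', R')"
    by (cases S, cases "fold (adjust \<alpha> t (G (Suc i))) (upd (Suc i)) S") auto
  have inv: "push_inv \<alpha> \<epsilon> t (G i) (reach_bound t i) P R" and R: "u \<in> pverts (G i) \<Longrightarrow> \<bar>R u\<bar> \<le> \<epsilon>" for u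
    using assms(2) update S by (force simp: config_inv_def)+
  have "push_inv \<alpha> \<epsilon> t (G (Suc i)) (reach_bound t (Suc i)) P' R'"
    using push_inv_flip[OF \<alpha> \<epsilon> digraph digraph flip inv R] update S by simp
  then show ?thesis using update S by (simp add: config_inv_def)
qed

lemma config_inv_exec:
  assumes "t \<in> pverts (G 0)"
  shows "push_exec \<alpha> \<epsilon> t G upd k c x \<Longrightarrow> config_inv t x"
  by (induction rule: push_exec.induct) (auto intro: config_inv_init config_inv_step assms)

lemma push_step_cases:
  assumes "push_step \<alpha> \<epsilon> t G upd k (i, ph, S) c y"
  obtains (push) u where "u \<in> pverts (G i)" "\<bar>snd S u\<bar> > \<epsilon>" "c = indeg (G i) u" "y = (i, ph, rev_push \<alpha> (G i) u S)"
  | (to_neg) "ph = Positive" "c = 0" "y = (i, Negative, S)"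
  | (update) "i < k" "ph = Negative" "\<forall>u\<in>pverts (G i). - \<epsilon> \<le> snd S u" "c = length (upd (Suc i))"
      "y = (Suc i, Positive, fold (adjust \<alpha> t (G (Suc i))) (upd (Suc i)) S)"
  using assms
proof cases
  case (push_pos u)
  then show ?thesis using push[of u] by simp
next
  case (push_neg u)
  then show ?thesis using push[of u] \<epsilon> by simp
qed (use that in auto)

definition potential :: "(nat \<Rightarrow> 'v \<Rightarrow> real) \<Rightarrow> 'v config \<Rightarrow> real" where
  "potential w = (\<lambda>(i, ph, S). \<Sum>u\<in>pverts (G i). w i u * \<bar>snd S u\<bar>)"

lemma potential_push:
  assumes i: "i \<le> k" and u: "u \<in> pverts (G i)" and w: "\<And>u. w i u \<ge> 0"
    and sub: "w i u \<ge> \<alpha> * g + (1 - \<alpha>) * (\<Sum>v\<in>pverts (G i). w i v * arc_prob (G i) v u)"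
    and Su: "\<bar>snd S u\<bar> > \<epsilon>" and g: "g \<ge> 0"
  shows "potential w (i, ph, rev_push \<alpha> (G i) u S) + \<alpha> * \<epsilon> * g \<le> potential w (i, ph, S)"
proof -
  have "potential w (i, ph, rev_push \<alpha> (G i) u S) \<le> potential w (i, ph, S) - \<alpha> * g * \<bar>snd S u\<bar>"
    unfolding potential_def using pair_digraph.rev_push_potential[OF digraph[OF i] \<alpha> u w sub] by simp
  moreover have "\<alpha> * g * \<epsilon> \<le> \<alpha> * g * \<bar>snd S u\<bar>"
    using \<alpha> g Su by (intro mult_left_mono) auto
  ultimately show ?thesis by (simp add: mult_ac)
qed

text \<open>Phase changes and updates raise \<open>stage\<close>, which is bounded, so an infinite
  run would end up pushing forever on one graph. There a potential drops by a fixed amount at each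
  push.\<close>

lemma no_infinite_run:
  assumes t: "t \<in> pverts (G 0)" and x0: "x 0 = init_config t"
    and steps: "\<And>j. push_step \<alpha> \<epsilon> t G upd k (x j) (c j) (x (Suc j))"
  shows False
proof -
  have inv: "config_inv t (x j)" for j
    by (induction j) (use x0 t steps in \<open>auto intro: config_inv_init config_inv_step\<close>)
  define stage where "stage y = 2 * fst y + (if fst (snd y) = Negative then 1 else 0)" for y :: "'v config"
  have stage_le: "stage (x j) \<le> 2 * k + 1" for j
    using inv[of j] by (auto simp: stage_def config_inv_def split: prod.splits)
  have step: "stage (x (Suc j)) = Suc (stage (x j)) \<or>
     (\<exists>i ph S u. x j = (i, ph, S) \<and> u \<in> pverts (G i) \<and> \<bar>snd S u\<bar> > \<epsilon> \<and> x (Suc j) = (i, ph, rev_push \<alpha> (G i) u S))" for j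
  proof -
    obtain i ph S where xj: "x j = (i, ph, S)" by (cases "x j")
    from steps[of j, unfolded xj] show ?thesis
    proof (cases rule: push_step_cases)
      case (push u)
      then show ?thesis using xj by blast
    qed (use xj in \<open>auto simp: stage_def\<close>)
  qed
  have "finite (range (\<lambda>j. stage (x j)))"
    by (rule finite_subset[of _ "{..2 * k + 1}"]) (use stage_le in auto)
  then have "Max (range (\<lambda>j. stage (x j))) \<in> range (\<lambda>j. stage (x j))" by (intro Max_in) auto
  then obtain N where N: "Max (range (\<lambda>j. stage (x j))) = stage (x N)" by auto
  have max: "stage (x j) \<le> stage (x N)" for j
    unfolding N[symmetric] by (rule Max_ge) (use \<open>finite _\<close> in auto)
  define i where "i = fst (x N)"
  \<comment> \<open>After an index of maximal \<open>stage\<close> only pushes are possible, and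
    they keep the graph.\<close>
  have tail: "stage (x (N + j)) = stage (x N) \<and> fst (x (N + j)) = i" for j
  proof (induction j)
    case (Suc j)
    from step[of "N + j"] show ?case
    proof
      assume "stage (x (Suc (N + j))) = Suc (stage (x (N + j)))"
      then show ?thesis using max[of "Suc (N + j)"] Suc by simp
    next
      assume "\<exists>i ph S u. x (N + j) = (i, ph, S) \<and> u \<in> pverts (G i) \<and> \<bar>snd S u\<bar> > \<epsilon> \<and> x (Suc (N + j)) = (i, ph, rev_push \<alpha> (G i) u S)"
      then show ?thesis using Suc by (auto simp: stage_def)
    qed
  qed (simp add: i_def)
  have i: "i \<le> k" using inv[of N] by (auto simp: i_def config_inv_def split: prod.splits)
  interpret Gi: pair_digraph "G i" by (rule digraph[OF i])
  \<comment> \<open>Unit cost instead of in-degree: a push at a vertex without in-neighbours is free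
    in the cost model, yet it must lower the potential here.\<close>
  define w where "w = (\<lambda>i. push_weight \<alpha> (G i) (\<lambda>_. 1))"
  have w: "w i u \<ge> 0" for u unfolding w_def by (intro Gi.push_weight_nonneg \<alpha>) simp
  have dec: "potential w (x (N + Suc j)) + \<alpha> * \<epsilon> \<le> potential w (x (N + j))" for j
  proof -
    from step[of "N + j"] tail[of j] tail[of "Suc j"] obtain ph S u where
      "x (N + j) = (i, ph, S)" "u \<in> pverts (G i)" "\<bar>snd S u\<bar> > \<epsilon>" "x (N + Suc j) = (i, ph, rev_push \<alpha> (G i) u S)"
      by auto
    moreover from this(2) have "w i u \<ge> \<alpha> * 1 + (1 - \<alpha>) * (\<Sum>v\<in>pverts (G i). w i v * arc_prob (G i) v u)"
      unfolding w_def using Gi.push_weight_eq[OF \<alpha>, of u "\<lambda>_. 1"] by simp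
    ultimately show ?thesis using potential_push[where w = w and g = 1, OF i _ w] by simp
  qed
  have "potential w (x (N + j)) + real j * (\<alpha> * \<epsilon>) \<le> potential w (x N)" for j
  proof (induction j)
    case (Suc j)
    then show ?case using dec[of j] by (simp add: algebra_simps)
  qed simp
  moreover have "potential w (x (N + j)) \<ge> 0" for j
    using tail[of j] w by (auto simp: potential_def split: prod.splits intro!: sum_nonneg)
  ultimately have le: "real j * (\<alpha> * \<epsilon>) \<le> potential w (x N)" for j
    by (smt (verit))
  obtain j where "potential w (x N) < real j * (\<alpha> * \<epsilon>)"
    using reals_Archimedean3[of "\<alpha> * \<epsilon>"] \<alpha> \<epsilon> by auto
  with le[of j] show False by simp
qed

lemma push_maintains_ppr:
  assumes t: "t \<in> pverts (G 0)"
  shows "maintains_ppr \<alpha> \<epsilon> t G upd k"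
  unfolding maintains_ppr_def
proof (intro conjI allI impI ballI notI)
  assume "\<exists>x c. x 0 = init_config t \<and> (\<forall>j. push_step \<alpha> \<epsilon> t G upd k (x j) (c j) (x (Suc j)))"
  then show False using no_infinite_run[OF t] by blast
next
  fix c i P R s
  assume exec: "push_exec \<alpha> \<epsilon> t G upd k c (i, Negative, P, R) \<and> (\<forall>u\<in>pverts (G i). - \<epsilon> \<le> R u)"
    and s: "s \<in> pverts (G i)" and nd: "no_dead_end (G i) s"
  then have inv: "i \<le> k" "push_inv \<alpha> \<epsilon> t (G i) (reach_bound t i) P R"
    and R: "u \<in> pverts (G i) \<Longrightarrow> \<bar>R u\<bar> \<le> \<epsilon>" for u
    using config_inv_exec[OF t] by (force simp: config_inv_def)+
  have "t \<in> pverts (G i)" using pverts_mono[OF inv(1)] t by auto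
  from pair_digraph.push_inv_accurate[OF digraph[OF inv(1)] \<alpha> inv(2) R s this nd]
  show "\<bar>P s - ppr \<alpha> (G i) s t\<bar> \<le> \<epsilon>" .
qed

definition arc_weight :: "(nat \<Rightarrow> 'v \<Rightarrow> real) \<Rightarrow> nat \<Rightarrow> real" where
  "arc_weight w i = (\<Sum>(u, v)\<in>set (upd i). w i u / real (outdeg (G i) u))"

definition weight_growth :: "(nat \<Rightarrow> 'v \<Rightarrow> real) \<Rightarrow> nat \<Rightarrow> real" where
  "weight_growth w i = (\<Sum>u\<in>pverts (G i). max 0 (w i u - w (i - 1) u))"

section \<open>Amortised cost for a general weight\<close>

context
  fixes w :: "nat \<Rightarrow> 'v \<Rightarrow> real"
  assumes w: "\<And>i u. i \<le> k \<Longrightarrow> w i u \<ge> 0"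
    and w_outside: "\<And>i u. i \<le> k \<Longrightarrow> u \<notin> pverts (G i) \<Longrightarrow> w i u = 0"
    and w_sub: "\<And>i u. i \<le> k \<Longrightarrow> u \<in> pverts (G i) \<Longrightarrow>
      w i u \<ge> \<alpha> * real (indeg (G i) u) + (1 - \<alpha>) * (\<Sum>v\<in>pverts (G i). w i v * arc_prob (G i) v u)"
begin

text \<open>Bounds the rise of the potential at update \<open>i\<close>. The last summand pays for
  the adjustments themselves, so that a single inequality covers all costs.\<close>

definition jump :: "'v \<Rightarrow> nat \<Rightarrow> real" where
  "jump t i = (\<Sum>(u, v)\<in>set (upd i). w i u / real (outdeg (G i) u) *
        ((reach_bound t i u + reach_bound t i v + 3 * \<epsilon> + of_bool (u = t)) / \<alpha>))
    + \<epsilon> * weight_growth w i + \<alpha> * \<epsilon> * real (length (upd i))"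

lemma jump_nonneg: "i \<le> k \<Longrightarrow> jump t i \<ge> 0"
  unfolding jump_def weight_growth_def
  using \<alpha> \<epsilon> w reach_bound_nonneg[of i t] by (intro add_nonneg_nonneg mult_nonneg_nonneg sum_nonneg) auto

text \<open>A push lowers the potential by at least \<alpha>\<epsilon> times its cost, and update
  \<open>j\<close> raises the left-hand side by at most \<open>jump t j\<close>. The initial
  residual is the unit vector at \<open>t\<close>, of potential \<open>w 0 t\<close>.\<close>

lemma exec_cost:
  assumes t: "t \<in> pverts (G 0)" and "push_exec \<alpha> \<epsilon> t G upd k c x"
  shows "\<alpha> * \<epsilon> * real c + potential w x \<le> w 0 t + (\<Sum>j\<in>{1..fst x}. jump t j)"
  using assms(2)
proof (induction rule: push_exec.induct)
  case start
  have "(\<Sum>u\<in>pverts (G 0). w 0 u * \<bar>of_bool (u = t)\<bar>) = (\<Sum>u\<in>{t}. w 0 u)"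
    using t pair_digraph.axioms(1)[OF digraph[of 0]]
    by (intro sum.mono_neutral_cong_right) (auto dest: pair_fin_digraph.pair_finite_verts)
  then show ?case by (simp add: potential_def init_config_def)
next
  case (step c x c' y)
  have inv: "config_inv t x" by (rule config_inv_exec[OF t step.hyps(1)])
  obtain i ph S where x: "x = (i, ph, S)" by (cases x)
  have i: "i \<le> k" using inv x by (auto simp: config_inv_def split: prod.splits)
  from step.hyps(2)[unfolded x] show ?case
  proof (cases rule: push_step_cases)
    case (push u)
    then show ?thesis
      using step.IH x potential_push[where w = w and ph = ph, OF i push(1) w[OF i] w_sub[OF i push(1)] push(2)]
      by (simp add: distrib_left)
  next
    case to_neg
    then show ?thesis using step.IH x by (simp add: potential_def)
  next
    case update
    obtain P R P' R' where S: "S = (P, R)" "fold (adjust \<alpha> t (G (Suc i))) (upd (Suc i)) S = (P', R')"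
      by (cases S, cases "fold (adjust \<alpha> t (G (Suc i))) (upd (Suc i)) S") auto
    have pinv: "push_inv \<alpha> \<epsilon> t (G i) (reach_bound t i) P R" and R: "u \<in> pverts (G i) \<Longrightarrow> \<bar>R u\<bar> \<le> \<epsilon>" for u
      using inv x update S by (force simp: config_inv_def)+
    have "i < k" by fact
    then have i': "Suc i \<le> k" by simp
    have "potential w y \<le> potential w x + (jump t (Suc i) - \<alpha> * \<epsilon> * real c')"
      using flip_potential[where w = "w i" and w' = "w (Suc i)", OF \<alpha> \<epsilon> digraph[OF i] digraph[OF i'] flip[OF \<open>i < k\<close>] pinv R S(2)[unfolded S(1)]
          w[OF i] w_outside[OF i] w[OF i']]
      by (simp add: potential_def x update S(2)[unfolded S(1)] S(1) jump_def weight_growth_def)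
    then show ?thesis using step.IH by (simp add: x update algebra_simps)
  qed
qed

lemma running_time_le:
  assumes t: "t \<in> pverts (G 0)"
  shows "running_time \<alpha> \<epsilon> t G upd k \<le> ennreal ((w 0 t + (\<Sum>j\<in>{1..k}. jump t j)) / (\<alpha> * \<epsilon>))"
  unfolding running_time_def
proof (rule SUP_least, clarify)
  fix c i ph P R assume exec: "push_exec \<alpha> \<epsilon> t G upd k c (i, ph, P, R)"
  have i: "i \<le> k" using config_inv_exec[OF t exec] by (simp add: config_inv_def)
  have "potential w (i, ph, P, R) \<ge> 0"
    using w[OF i] by (auto simp: potential_def intro!: sum_nonneg)
  moreover have "(\<Sum>j\<in>{1..i}. jump t j) \<le> (\<Sum>j\<in>{1..k}. jump t j)"
    using i jump_nonneg by (intro sum_mono2) auto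
  ultimately have "\<alpha> * \<epsilon> * real c \<le> w 0 t + (\<Sum>j\<in>{1..k}. jump t j)"
    using exec_cost[OF t exec] by simp
  then have "real c \<le> (w 0 t + (\<Sum>j\<in>{1..k}. jump t j)) / (\<alpha> * \<epsilon>)"
    using \<alpha> \<epsilon> by (simp add: field_simps)
  then show "of_nat c \<le> ennreal ((w 0 t + (\<Sum>j\<in>{1..k}. jump t j)) / (\<alpha> * \<epsilon>))"
    by (simp add: ennreal_of_nat_eq_real_of_nat ennreal_leI)
qed

text \<open>The weights do not depend on the target, so only the numerators are summed over
  \<open>T\<close>: the two reach bounds and the indicator contribute at most \<open>1\<close>
  each.\<close>

lemma sum_jump_le:
  assumes T: "finite T" and i: "i \<le> k"
  shows "(\<Sum>t\<in>T. jump t i) \<le> arc_weight w i * ((3 + 3 * real (card T) * \<epsilon>) / \<alpha>)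
    + real (card T) * (\<epsilon> * weight_growth w i) + real (card T) * (\<alpha> * \<epsilon> * real (length (upd i)))"
proof -
  have *: "(\<Sum>t\<in>T. (reach_bound t i u + reach_bound t i v + 3 * \<epsilon> + of_bool (u = t)) / \<alpha>)
      \<le> (3 + 3 * real (card T) * \<epsilon>) / \<alpha>" for u v
  proof -
    have "(\<Sum>t\<in>T. of_bool (u = t) :: real) \<le> 1"
      using T by (simp add: of_bool_def sum.delta')
    then have "(\<Sum>t\<in>T. reach_bound t i u + reach_bound t i v + 3 * \<epsilon> + of_bool (u = t)) \<le> 3 + 3 * real (card T) * \<epsilon>"
      using sum_reach_bound[OF T, of i u] sum_reach_bound[OF T, of i v] i by (simp only: sum.distrib) simp
    then show ?thesis using \<alpha> by (simp only: flip: sum_divide_distrib) (intro divide_right_mono, auto)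
  qed
  have "(\<Sum>t\<in>T. \<Sum>(u, v)\<in>set (upd i). w i u / real (outdeg (G i) u) *
        ((reach_bound t i u + reach_bound t i v + 3 * \<epsilon> + of_bool (u = t)) / \<alpha>))
     = (\<Sum>(u, v)\<in>set (upd i). w i u / real (outdeg (G i) u) *
        (\<Sum>t\<in>T. (reach_bound t i u + reach_bound t i v + 3 * \<epsilon> + of_bool (u = t)) / \<alpha>))"
    by (subst sum.swap) (simp add: sum_distrib_left case_prod_unfold)
  also have "\<dots> \<le> (\<Sum>(u, v)\<in>set (upd i). w i u / real (outdeg (G i) u) * ((3 + 3 * real (card T) * \<epsilon>) / \<alpha>))"
    unfolding case_prod_unfold by (intro sum_mono mult_left_mono * divide_nonneg_nonneg w[OF i]) simp
  also have "\<dots> = arc_weight w i * ((3 + 3 * real (card T) * \<epsilon>) / \<alpha>)"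
    by (simp only: arc_weight_def sum_distrib_right case_prod_unfold)
  finally show ?thesis by (simp add: jump_def sum.distrib)
qed

lemma sum_running_time_le:
  assumes T: "T \<subseteq> pverts (G 0)"
  shows "(\<Sum>t\<in>T. running_time \<alpha> \<epsilon> t G upd k) \<le> ennreal (((\<Sum>t\<in>T. w 0 t) +
    (\<Sum>i\<in>{1..k}. arc_weight w i * ((3 + 3 * real (card T) * \<epsilon>) / \<alpha>)
      + real (card T) * (\<epsilon> * weight_growth w i) + real (card T) * (\<alpha> * \<epsilon> * real (length (upd i))))) / (\<alpha> * \<epsilon>))"
proof -
  have fin: "finite T"
    using T pair_digraph.axioms(1)[OF digraph[of 0]] by (auto dest: pair_fin_digraph.pair_finite_verts intro: finite_subset)
  have nonneg: "0 \<le> w 0 t + (\<Sum>i\<in>{1..k}. jump t i)" for t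
    using w[of 0] jump_nonneg by (intro add_nonneg_nonneg sum_nonneg) auto
  have "(\<Sum>t\<in>T. running_time \<alpha> \<epsilon> t G upd k) \<le> (\<Sum>t\<in>T. ennreal ((w 0 t + (\<Sum>i\<in>{1..k}. jump t i)) / (\<alpha> * \<epsilon>)))"
    using T by (intro sum_mono running_time_le) auto
  also have "\<dots> = ennreal ((\<Sum>t\<in>T. w 0 t + (\<Sum>i\<in>{1..k}. jump t i)) / (\<alpha> * \<epsilon>))"
    using nonneg \<alpha> \<epsilon> by (subst sum_ennreal) (auto simp: sum_divide_distrib)
  also have "\<dots> \<le> ennreal (((\<Sum>t\<in>T. w 0 t) + (\<Sum>i\<in>{1..k}. \<Sum>t\<in>T. jump t i)) / (\<alpha> * \<epsilon>))"
    by (simp add: sum.distrib) (subst sum.swap, simp)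
  also have "\<dots> \<le> ennreal (((\<Sum>t\<in>T. w 0 t) + (\<Sum>i\<in>{1..k}. arc_weight w i * ((3 + 3 * real (card T) * \<epsilon>) / \<alpha>)
      + real (card T) * (\<epsilon> * weight_growth w i) + real (card T) * (\<alpha> * \<epsilon> * real (length (upd i))))) / (\<alpha> * \<epsilon>))"
    using \<alpha> \<epsilon> sum_jump_le[OF fin]
    by (intro ennreal_leI divide_right_mono add_left_mono sum_mono) auto
  finally show ?thesis .
qed

end

end

section \<open>Averages over a uniform choice\<close>

lemma nn_integral_pmf_of_set_le:
  assumes "finite A" "A \<noteq> {}" and "(\<Sum>a\<in>A. f a) \<le> ennreal x" and "x / real (card A) \<le> y"
  shows "(\<integral>\<^sup>+ a. f a \<partial>measure_pmf (pmf_of_set A)) \<le> ennreal y"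
proof -
  have card: "real (card A) > 0" using assms(1,2) by (simp add: card_gt_0_iff)
  have "(\<integral>\<^sup>+ a. f a \<partial>measure_pmf (pmf_of_set A)) = (\<Sum>a\<in>A. f a) / ennreal (real (card A))"
    using assms(1,2) by (simp add: nn_integral_pmf_of_set ennreal_of_nat_eq_real_of_nat)
  also have "\<dots> \<le> ennreal x / ennreal (real (card A))"
    using assms(3) by (rule divide_right_mono_ennreal)
  also have "\<dots> \<le> ennreal y"
  proof (cases "x \<ge> 0")
    case True
    then show ?thesis using card assms(4) by (simp add: divide_ennreal ennreal_leI)
  next
    case False
    then show ?thesis by (simp add: ennreal_neg)
  qed
  finally show ?thesis .
qed

section \<open>Undirected graphs\<close>

lemma flip_edge_pair_graph:
  assumes G: "pair_graph G" and uv: "u \<noteq> v"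
  shows "pair_graph (flip_edge (u, v) G)" and "arc_flip G (flip_edge (u, v) G) [(u, v), (v, u)]"
proof -
  interpret pair_graph G by (rule G)
  have sym: "(x, y) \<in> parcs G \<Longrightarrow> (y, x) \<in> parcs G" for x y
    by (rule arcs_symmetric)
  show "pair_graph (flip_edge (u, v) G)"
  proof
    show "finite (pverts (flip_edge (u, v) G))" "finite (parcs (flip_edge (u, v) G))"
      using pair_finite_verts pair_finite_arcs by (auto simp: flip_edge_def)
    show "symmetric (with_proj (flip_edge (u, v) G))"
      using sym by (auto simp: symmetric_def flip_edge_def intro!: symI)
    fix e assume e: "e \<in> parcs (flip_edge (u, v) G)"
    then show "fst e \<noteq> snd e"
      using uv pair_no_loops[of e] by (auto simp: flip_edge_def split: if_splits)
    show "fst e \<in> pverts (flip_edge (u, v) G)" "snd e \<in> pverts (flip_edge (u, v) G)"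
      using e wellformed' by (auto simp: flip_edge_def split: if_splits)
  qed
  show "arc_flip G (flip_edge (u, v) G) [(u, v), (v, u)]"
    using sym uv by (auto simp: arc_flip_def flip_edge_def)
qed

lemma outdeg_flip_le:
  assumes "pair_digraph G" "pair_digraph G'" "arc_flip G G' L"
  shows "outdeg G' u \<le> outdeg G u + of_bool (u \<in> fst ` set L)"
proof (cases "u \<in> fst ` set L")
  case False
  then show ?thesis using arc_flip_out(1)[OF assms(3)] by (simp add: outdeg_eq_card)
next
  case True
  then obtain v where L: "(u, v) \<in> set L" by force
  have fin: "finite {y. (u, y) \<in> parcs G}" "finite {y. (u, y) \<in> parcs G'}"
    using assms(1,2) by (auto intro: pair_digraph.finite_out)
  show ?thesis
  proof (cases "(u, v) \<in> parcs G'")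
    case T: True
    show ?thesis using arc_flip_out(2)[OF assms(3) L T] fin True by (simp add: outdeg_eq_card)
  next
    case F: False
    show ?thesis using arc_flip_out(3)[OF assms(3) L F] fin True by (simp add: outdeg_eq_card)
  qed
qed

lemma undirected_updates_dynamic_graph:
  assumes \<alpha>: "0 < \<alpha>" "\<alpha> < 1" and \<epsilon>: "\<epsilon> > 0" and U: "undirected_updates G e k"
  shows "i \<le> k \<Longrightarrow> pair_graph (G i)" and "dynamic_graph \<alpha> \<epsilon> G (both_arcs e) k"
proof -
  have step: "G (Suc i) = flip_edge (fst (e (Suc i)), snd (e (Suc i))) (G i)" "fst (e (Suc i)) \<noteq> snd (e (Suc i))"
    if "i < k" for i
    using U that by (auto simp: undirected_updates_def)
  have graph: "i \<le> k \<Longrightarrow> pair_graph (G i)" for i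
  proof (induction i)
    case 0
    then show ?case using U by (simp add: undirected_updates_def)
  next
    case (Suc i)
    then show ?case using step[of i] flip_edge_pair_graph(1)[of "G i" "fst (e (Suc i))" "snd (e (Suc i))"] by simp
  qed
  then show "i \<le> k \<Longrightarrow> pair_graph (G i)" .
  show "dynamic_graph \<alpha> \<epsilon> G (both_arcs e) k"
  proof (rule dynamic_graph.intro)
    show "i \<le> k \<Longrightarrow> pair_digraph (G i)" for i
      using graph pair_graph.axioms(1) by blast
    show "arc_flip (G i) (G (Suc i)) (both_arcs e (Suc i))" if i: "i < k" for i
      using flip_edge_pair_graph(2)[OF graph[of i] step(2)[OF i]] step(1)[OF i] i
      by (simp add: both_arcs_def prod.swap_def)
  qed (use \<alpha> \<epsilon> in auto)
qed

text \<open>By symmetry the out-degree satisfies the weight condition with equality. An update flips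
  two arcs of ratio at most \<open>1\<close>, raises two degrees by at most one each, and makes two
  adjustments.\<close>

lemma undirected_running_time:
  assumes \<alpha>: "0 < \<alpha>" "\<alpha> < 1" and \<epsilon>: "\<epsilon> > 0" and U: "undirected_updates G e k"
    and n: "n = card (pverts (G 0))"
  shows "(\<integral>\<^sup>+ t. running_time \<alpha> \<epsilon> t G (both_arcs e) k \<partial>measure_pmf (pmf_of_set (pverts (G 0))))
    \<le> ennreal (6 * real k / (real n * \<epsilon> * \<alpha>\<^sup>2) + 6 * real k / \<alpha>\<^sup>2 + 2 * real k / \<alpha> + 2 * real k + avg_degree (G 0) / (\<alpha> * \<epsilon>))"
proof -
  note graph = undirected_updates_dynamic_graph(1)[OF assms(1-4)]
  interpret dynamic_graph \<alpha> \<epsilon> G "both_arcs e" k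
    by (rule undirected_updates_dynamic_graph(2)[OF assms(1-4)])
  define w where "w i u = real (outdeg (G i) u)" for i u
  define V where "V = pverts (G 0)"
  interpret G0: pair_digraph "G 0" by (rule digraph) simp
  have V: "finite V" "V \<noteq> {}"
    using U G0.pair_finite_verts by (auto simp: undirected_updates_def V_def)
  then have npos: "real n > 0" by (simp add: n V_def card_gt_0_iff)
  have w0: "w i u \<ge> 0" for i u by (simp add: w_def)
  have w_outside: "w i u = 0" if "i \<le> k" "u \<notin> pverts (G i)" for i u
    using pair_digraph.outdeg_outside[OF digraph] that by (simp add: w_def)
  have w_sub: "w i u \<ge> \<alpha> * real (indeg (G i) u) + (1 - \<alpha>) * (\<Sum>v\<in>pverts (G i). w i v * arc_prob (G i) v u)"
    if i: "i \<le> k" and u: "u \<in> pverts (G i)" for i u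
  proof -
    interpret Gi: pair_graph "G i" by (rule graph[OF i])
    have "{v. (v, u) \<in> parcs (G i)} = {v. (u, v) \<in> parcs (G i)}"
      using Gi.arcs_symmetric by blast
    then have deg: "indeg (G i) u = outdeg (G i) u" by (simp add: indeg_eq_card outdeg_eq_card)
    have "w i v * arc_prob (G i) v u = 1 * of_bool ((v, u) \<in> parcs (G i))" for v
      using Gi.outdeg_pos[of v u] by (auto simp: w_def arc_prob_def)
    then have "(\<Sum>v\<in>pverts (G i). w i v * arc_prob (G i) v u) = real (indeg (G i) u)"
      unfolding Gi.sum_in[of "\<lambda>_. 1", symmetric] by (simp only: Gi.sum_in indeg_eq_card) simp
    then show ?thesis by (simp add: w_def deg algebra_simps)
  qed
  have len: "length (both_arcs e i) = 2" for i by (simp add: both_arcs_def)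
  \<comment> \<open>The ratio is \<open>1\<close>, or \<open>0\<close> by division by zero if the
    tail has just lost its last arc.\<close>
  have aw: "arc_weight w i \<le> 2" for i
  proof -
    have "arc_weight w i \<le> (\<Sum>a\<in>set (both_arcs e i). 1)"
      unfolding arc_weight_def by (intro sum_mono) (auto simp: w_def)
    also have "\<dots> \<le> real (length (both_arcs e i))" using card_length[of "both_arcs e i"] by simp
    finally show ?thesis by (simp add: len)
  qed
  have wg: "weight_growth w i \<le> 2" if i: "i \<in> {1..k}" for i
  proof -
    obtain j where j: "i = Suc j" "j < k" using i by (cases i) auto
    interpret Gi: pair_digraph "G i" by (rule digraph) (use i in auto)
    have "weight_growth w i \<le> (\<Sum>u\<in>pverts (G i). of_bool (u \<in> fst ` set (both_arcs e i)))"
      unfolding weight_growth_def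
    proof (rule sum_mono)
      fix u
      have "outdeg (G i) u \<le> outdeg (G (i - 1)) u + of_bool (u \<in> fst ` set (both_arcs e i))"
        using outdeg_flip_le[OF digraph digraph flip[OF j(2)]] j by simp
      then have "real (outdeg (G i) u) \<le> real (outdeg (G (i - 1)) u + of_bool (u \<in> fst ` set (both_arcs e i)))"
        by (simp only: of_nat_le_iff)
      then show "max 0 (w i u - w (i - 1) u) \<le> of_bool (u \<in> fst ` set (both_arcs e i))"
        by (simp add: w_def)
    qed
    also have "\<dots> \<le> real (card (fst ` set (both_arcs e i)))"
      using Gi.pair_finite_verts by (simp add: of_bool_def sum.If_cases card_mono)
    also have "\<dots> \<le> real (length (both_arcs e i))"
      using card_image_le[of "set (both_arcs e i)" fst] card_length[of "both_arcs e i"] by simp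
    finally show ?thesis by (simp add: len)
  qed
  \<comment> \<open>The bound for one update, with each of the three quantities replaced by
    \<open>2\<close>; dividing by \<open>n\<close>, \<alpha> and \<epsilon> gives the four terms
    with \<open>k\<close>.\<close>
  define c where "c = 2 * ((3 + 3 * real n * \<epsilon>) / \<alpha>) + real n * (\<epsilon> * 2) + real n * (\<alpha> * \<epsilon> * 2)"
  have "(\<Sum>i\<in>{1..k}. arc_weight w i * ((3 + 3 * real (card V) * \<epsilon>) / \<alpha>)
      + real (card V) * (\<epsilon> * weight_growth w i) + real (card V) * (\<alpha> * \<epsilon> * real (length (both_arcs e i)))) \<le> (\<Sum>i\<in>{1..k}. c)"
  proof (rule sum_mono)
    fix i assume "i \<in> {1..k}"
    then show "arc_weight w i * ((3 + 3 * real (card V) * \<epsilon>) / \<alpha>)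
      + real (card V) * (\<epsilon> * weight_growth w i) + real (card V) * (\<alpha> * \<epsilon> * real (length (both_arcs e i))) \<le> c"
      unfolding c_def n V_def[symmetric] len
      by (intro add_mono mult_right_mono mult_left_mono aw wg order_refl) (use \<alpha> \<epsilon> in auto)
  qed
  then have "(\<Sum>i\<in>{1..k}. arc_weight w i * ((3 + 3 * real (card V) * \<epsilon>) / \<alpha>)
      + real (card V) * (\<epsilon> * weight_growth w i) + real (card V) * (\<alpha> * \<epsilon> * real (length (both_arcs e i)))) \<le> real k * c"
    by simp
  then have "(\<Sum>t\<in>V. running_time \<alpha> \<epsilon> t G (both_arcs e) k) \<le> ennreal (((\<Sum>t\<in>V. w 0 t) + real k * c) / (\<alpha> * \<epsilon>))"
    using \<alpha> \<epsilon> order_refl[of V]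
    by (intro order_trans[OF sum_running_time_le[of w V, OF w0 w_outside w_sub]] ennreal_leI divide_right_mono add_left_mono)
      (auto simp: V_def)
  then show ?thesis
    unfolding V_def[symmetric]
  proof (rule nn_integral_pmf_of_set_le[OF V])
    have "(\<Sum>t\<in>V. w 0 t) = real n * avg_degree (G 0)"
      using npos by (simp add: w_def avg_degree_def n V_def)
    then show "((\<Sum>t\<in>V. w 0 t) + real k * c) / (\<alpha> * \<epsilon>) / real (card V)
      \<le> 6 * real k / (real n * \<epsilon> * \<alpha>\<^sup>2) + 6 * real k / \<alpha>\<^sup>2 + 2 * real k / \<alpha> + 2 * real k + avg_degree (G 0) / (\<alpha> * \<epsilon>)"
      unfolding n[folded V_def, symmetric] c_def
      using npos \<alpha> \<epsilon> by (simp add: field_simps power2_eq_square)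
  qed
qed

section \<open>Random arrival order\<close>

context pair_digraph
begin

lemma sum_arc_prob_le:
  assumes "\<And>u. z u \<ge> 0"
  shows "(\<Sum>v\<in>pverts G. \<Sum>u\<in>pverts G. z u * arc_prob G u v) \<le> (\<Sum>u\<in>pverts G. z u)"
proof -
  have "(\<Sum>v\<in>pverts G. \<Sum>u\<in>pverts G. z u * arc_prob G u v) = (\<Sum>u\<in>pverts G. z u * (\<Sum>v\<in>pverts G. arc_prob G u v))"
    unfolding sum_distrib_left by (rule sum.swap)
  also have "\<dots> \<le> (\<Sum>u\<in>pverts G. z u)"
    unfolding sum_arc_prob using assms by (intro sum_mono mult_left_le) auto
  finally show ?thesis .
qed

context
  fixes \<alpha> :: real
  assumes \<alpha>: "0 < \<alpha>" "\<alpha> < 1"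
begin

text \<open>
  Along arcs into vertices of in-degree one the excess of the weight over \<open>1\<close> contracts, so only the
  remaining arcs contribute to its total.
\<close>
lemma arc_weight_multiple_in:
  defines "w \<equiv> push_weight \<alpha> G (\<lambda>v. real (indeg G v))"
    and "M \<equiv> {a \<in> parcs G. indeg G (snd a) \<ge> 2}"
  shows "(\<Sum>(u, v)\<in>M. w u / real (outdeg G u)) \<le> (1 + 1 / \<alpha>) * real (card M)"
proof -
  define z where "z u = max 0 (w u - 1)" for u
  have w: "w u \<ge> 0" for u unfolding w_def by (intro push_weight_nonneg \<alpha>) simp
  have z: "z u \<ge> 0" "w u \<le> z u + 1" for u by (auto simp: z_def)
  have weight: "w u * arc_prob G u v \<le> z u * arc_prob G u v + 1 * of_bool ((u, v) \<in> parcs G)" for u v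
  proof (cases "(u, v) \<in> parcs G")
    case True
    then have "arc_prob G u v \<le> 1" "arc_prob G u v \<ge> 0"
      using outdeg_pos[OF True] by (auto simp: arc_prob_def)
    then have "w u * arc_prob G u v \<le> (z u + 1) * arc_prob G u v" "1 * arc_prob G u v \<le> 1"
      using z by (auto intro!: mult_right_mono)
    then show ?thesis using True by (simp add: algebra_simps)
  qed (simp add: arc_prob_def)
  have card_M: "(\<Sum>v\<in>pverts G. of_bool (indeg G v \<ge> 2) * real (indeg G v)) = real (card M)"
  proof -
    have "real (card M) = (\<Sum>a\<in>parcs G. of_bool (indeg G (snd a) \<ge> 2))"
      using pair_finite_arcs by (simp add: M_def of_bool_def sum.If_cases Int_def conj_commute)
    also have "\<dots> = (\<Sum>v\<in>pverts G. of_bool (indeg G v \<ge> 2) * real (indeg G v))"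
      unfolding sum_arcs by (intro sum.cong refl) (simp add: indeg_eq_card)
    finally show ?thesis by simp
  qed
  have flow: "(\<Sum>v\<in>pverts G. \<Sum>u\<in>pverts G. z u * arc_prob G u v) \<le> (\<Sum>u\<in>pverts G. z u)"
    by (rule sum_arc_prob_le) (simp add: z)
  \<comment> \<open>Writing the weight as at most excess plus one, the ones contribute
    \<open>indeg G v\<close> in all. If that is at most \<open>1\<close>, it is cancelled by the
    \<open>1\<close> subtracted in \<open>z\<close>, and only the inherited excess remains.\<close>
  have "z v \<le> of_bool (indeg G v \<ge> 2) * real (indeg G v) + (1 - \<alpha>) * (\<Sum>u\<in>pverts G. z u * arc_prob G u v)"
    if v: "v \<in> pverts G" for v
  proof -
    have "(\<Sum>u\<in>pverts G. w u * arc_prob G u v)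
        \<le> (\<Sum>u\<in>pverts G. z u * arc_prob G u v + 1 * of_bool ((u, v) \<in> parcs G))"
      by (intro sum_mono weight)
    also have "\<dots> = (\<Sum>u\<in>pverts G. z u * arc_prob G u v) + real (indeg G v)"
      by (simp only: sum.distrib sum_in) (simp add: indeg_eq_card)
    finally have "w v \<le> \<alpha> * real (indeg G v) + (1 - \<alpha>) * ((\<Sum>u\<in>pverts G. z u * arc_prob G u v) + real (indeg G v))"
      using \<alpha> push_weight_eq[OF \<alpha> v, of "\<lambda>v. real (indeg G v)"] unfolding w_def[symmetric]
      by (simp add: mult_left_mono)
    then have "w v \<le> real (indeg G v) + (1 - \<alpha>) * (\<Sum>u\<in>pverts G. z u * arc_prob G u v)"
      by (simp add: algebra_simps)
    moreover have "(1 - \<alpha>) * (\<Sum>u\<in>pverts G. z u * arc_prob G u v) \<ge> 0"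
      using \<alpha> z by (intro mult_nonneg_nonneg sum_nonneg arc_prob_nonneg) auto
    moreover have "\<not> indeg G v \<ge> 2 \<Longrightarrow> real (indeg G v) \<le> 1" by simp
    ultimately show ?thesis unfolding z_def[of v] by (cases "indeg G v \<ge> 2") auto
  qed
  then have "(\<Sum>v\<in>pverts G. z v) \<le> (\<Sum>v\<in>pverts G. of_bool (indeg G v \<ge> 2) * real (indeg G v)
      + (1 - \<alpha>) * (\<Sum>u\<in>pverts G. z u * arc_prob G u v))"
    by (rule sum_mono)
  also have "\<dots> = real (card M) + (1 - \<alpha>) * (\<Sum>v\<in>pverts G. \<Sum>u\<in>pverts G. z u * arc_prob G u v)"
    by (simp only: sum.distrib card_M sum_distrib_left)
  also have "\<dots> \<le> real (card M) + (1 - \<alpha>) * (\<Sum>u\<in>pverts G. z u)"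
    using \<alpha> flow by (intro add_left_mono mult_left_mono) auto
  \<comment> \<open>The sum of the excess is at most \<open>card M\<close> plus
    \<open>(1 - \<alpha>)\<close> times itself.\<close>
  finally have sum_z: "(\<Sum>v\<in>pverts G. z v) \<le> real (card M) / \<alpha>"
    using \<alpha> by (simp add: field_simps)
  have "(\<Sum>(u, v)\<in>M. w u / real (outdeg G u)) \<le> (\<Sum>(u, v)\<in>M. z u * arc_prob G u v + 1)"
  proof (rule sum_mono, clarify)
    fix u v assume "(u, v) \<in> M"
    then show "w u / real (outdeg G u) \<le> z u * arc_prob G u v + 1"
      using weight[of u v] by (simp add: M_def arc_prob_def)
  qed
  also have "\<dots> = (\<Sum>(u, v)\<in>M. z u * arc_prob G u v) + real (card M)"
    by (simp add: case_prod_unfold sum.distrib)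
  also have "(\<Sum>(u, v)\<in>M. z u * arc_prob G u v) \<le> (\<Sum>(u, v)\<in>parcs G. z u * arc_prob G u v)"
    using pair_finite_arcs by (intro sum_mono2) (auto simp: M_def z arc_prob_nonneg intro!: mult_nonneg_nonneg)
  also have "\<dots> \<le> (\<Sum>v\<in>pverts G. \<Sum>u\<in>pverts G. z u * arc_prob G u v)"
    unfolding sum_arcs prod.case using pair_finite_verts
    by (intro sum_mono sum_mono2) (auto simp: z arc_prob_nonneg dest: in_arcsD1 intro!: mult_nonneg_nonneg)
  also note flow
  also note sum_z
  finally show ?thesis by (simp add: algebra_simps)
qed

end

end

text \<open>Subtracting the two weight equations shows that the positive part \<open>D\<close> of
  the growth has its only source at \<open>y\<close>: \<alpha> for the additional in-degree and at
  most \<open>r\<close> for the flow over the new arc. Everything else is transported with factor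
  \<open>1 - \<alpha>\<close>, so summation yields \<open>\<alpha> + r\<close> over
  \<alpha>.\<close>

lemma push_weight_growth:
  assumes \<alpha>: "0 < \<alpha>" "\<alpha> < 1" and G: "pair_digraph G" and G': "pair_digraph G'"
    and V: "pverts G' = pverts G" and arcs: "parcs G' = insert (x, y) (parcs G)" "(x, y) \<notin> parcs G"
  defines "w \<equiv> push_weight \<alpha> G (\<lambda>v. real (indeg G v))" and "w' \<equiv> push_weight \<alpha> G' (\<lambda>v. real (indeg G' v))"
  shows "(\<Sum>u\<in>pverts G'. max 0 (w' u - w u)) \<le> 1 + w' x / real (outdeg G' x) / \<alpha>"
proof -
  interpret G: pair_digraph G by (rule G)
  interpret G': pair_digraph G' by (rule G')
  define r where "r = w' x / real (outdeg G' x)"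
  define D where "D u = max 0 (w' u - w u)" for u
  have w': "w' u \<ge> 0" for u unfolding w'_def by (intro G'.push_weight_nonneg \<alpha>) simp
  then have r: "r \<ge> 0" by (simp add: r_def)
  have y: "y \<in> pverts G" using arcs G'.in_arcsD2[of x y] V by simp
  have "{y. (x, y) \<in> parcs G'} = insert y {y. (x, y) \<in> parcs G}" using arcs by auto
  then have out_x: "outdeg G' x = Suc (outdeg G x)"
    using arcs(2) G.finite_out[of x] by (simp add: outdeg_eq_card)
  have "{z. (u, z) \<in> parcs G'} = {z. (u, z) \<in> parcs G}" if "u \<noteq> x" for u using that arcs by auto
  then have out: "outdeg G' u = outdeg G u" if "u \<noteq> x" for u using that by (simp add: outdeg_eq_card)
  have "{u. (u, y) \<in> parcs G'} = insert x {u. (u, y) \<in> parcs G}" using arcs by auto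
  then have "indeg G' y = Suc (indeg G y)"
    using arcs(2) G.finite_in[of y] by (simp add: indeg_eq_card)
  moreover have "{u. (u, v) \<in> parcs G'} = {u. (u, v) \<in> parcs G}" if "v \<noteq> y" for v using that arcs by auto
  then have "indeg G' v = indeg G v" if "v \<noteq> y" for v using that by (simp add: indeg_eq_card)
  ultimately have indeg: "real (indeg G' v) = real (indeg G v) + of_bool (v = y)" for v by simp
  \<comment> \<open>The old out-neighbours of \<open>x\<close> get a smaller share than before; only
    \<open>y\<close> gains.\<close>
  have prob: "w' u * arc_prob G' u v \<le> w' u * arc_prob G u v + (if u = x then r * of_bool (v = y) else 0)" for u v
  proof (cases "u = x")
    case True
    have "arc_prob G' x v \<le> arc_prob G x v + of_bool (v = y) / real (outdeg G' x)"
    proof (cases "v = y")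
      case False
      then show ?thesis
        using G.outdeg_pos[of x v] arcs by (auto simp: arc_prob_def out_x field_simps)
    qed (simp add: arc_prob_def arcs)
    then have "w' x * arc_prob G' x v \<le> w' x * (arc_prob G x v + of_bool (v = y) / real (outdeg G' x))"
      by (intro mult_left_mono w')
    then show ?thesis using True by (simp add: r_def algebra_simps)
  next
    case False
    then show ?thesis using arcs by (simp add: arc_prob_def out)
  qed
  have x: "x \<in> pverts G" using arcs G'.in_arcsD1[of x y] V by simp
  have "D v \<le> (\<alpha> + r) * of_bool (v = y) + (1 - \<alpha>) * (\<Sum>u\<in>pverts G. D u * arc_prob G u v)"
    if v: "v \<in> pverts G" for v
  proof -
    have "(\<Sum>u\<in>pverts G. w' u * arc_prob G' u v)
        \<le> (\<Sum>u\<in>pverts G. w' u * arc_prob G u v + (if u = x then r * of_bool (v = y) else 0))"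
      by (intro sum_mono prob)
    also have "\<dots> = (\<Sum>u\<in>pverts G. w' u * arc_prob G u v) + r * of_bool (v = y)"
      using x G.pair_finite_verts by (simp add: sum.distrib sum.delta)
    finally have "(\<Sum>u\<in>pverts G. w' u * arc_prob G' u v) - (\<Sum>u\<in>pverts G. w u * arc_prob G u v)
       \<le> (\<Sum>u\<in>pverts G. (w' u - w u) * arc_prob G u v) + r * of_bool (v = y)"
      by (simp add: left_diff_distrib sum_subtractf)
    also have "\<dots> \<le> (\<Sum>u\<in>pverts G. D u * arc_prob G u v) + r * of_bool (v = y)"
      by (intro add_right_mono sum_mono mult_right_mono) (auto simp: D_def arc_prob_nonneg)
    finally have le: "(\<Sum>u\<in>pverts G. w' u * arc_prob G' u v) - (\<Sum>u\<in>pverts G. w u * arc_prob G u v)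
       \<le> (\<Sum>u\<in>pverts G. D u * arc_prob G u v) + r * of_bool (v = y)" .
    have "w' v - w v = \<alpha> * of_bool (v = y) + (1 - \<alpha>) *
        ((\<Sum>u\<in>pverts G. w' u * arc_prob G' u v) - (\<Sum>u\<in>pverts G. w u * arc_prob G u v))"
      using G'.push_weight_eq[OF \<alpha>, of v "\<lambda>v. real (indeg G' v)"] G.push_weight_eq[OF \<alpha> v, of "\<lambda>v. real (indeg G v)"] v
      unfolding w_def[symmetric] w'_def[symmetric] V by (simp add: indeg algebra_simps)
    also have "\<dots> \<le> \<alpha> * of_bool (v = y) + (1 - \<alpha>) *
        ((\<Sum>u\<in>pverts G. D u * arc_prob G u v) + r * of_bool (v = y))"
      using \<alpha> le by (intro add_left_mono mult_left_mono) auto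
    also have "\<dots> \<le> (\<alpha> + r) * of_bool (v = y) + (1 - \<alpha>) * (\<Sum>u\<in>pverts G. D u * arc_prob G u v)"
      using \<alpha> r by (simp add: algebra_simps)
    finally have "w' v - w v \<le> (\<alpha> + r) * of_bool (v = y) + (1 - \<alpha>) * (\<Sum>u\<in>pverts G. D u * arc_prob G u v)" .
    moreover have "0 \<le> (\<alpha> + r) * of_bool (v = y) + (1 - \<alpha>) * (\<Sum>u\<in>pverts G. D u * arc_prob G u v)"
      using \<alpha> r by (intro add_nonneg_nonneg mult_nonneg_nonneg sum_nonneg arc_prob_nonneg) (auto simp: D_def)
    ultimately show ?thesis by (simp add: D_def[of v])
  qed
  then have "(\<Sum>v\<in>pverts G. D v)
      \<le> (\<Sum>v\<in>pverts G. (\<alpha> + r) * of_bool (v = y) + (1 - \<alpha>) * (\<Sum>u\<in>pverts G. D u * arc_prob G u v))"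
    by (rule sum_mono)
  also have "\<dots> = (\<alpha> + r) * (\<Sum>v\<in>pverts G. of_bool (v = y)) + (1 - \<alpha>) * (\<Sum>v\<in>pverts G. \<Sum>u\<in>pverts G. D u * arc_prob G u v)"
    by (simp only: sum.distrib sum_distrib_left)
  also have "\<dots> = (\<alpha> + r) + (1 - \<alpha>) * (\<Sum>v\<in>pverts G. \<Sum>u\<in>pverts G. D u * arc_prob G u v)"
    using y G.pair_finite_verts by (simp add: of_bool_def sum.delta)
  also have "\<dots> \<le> (\<alpha> + r) + (1 - \<alpha>) * (\<Sum>u\<in>pverts G. D u)"
    using \<alpha> G.sum_arc_prob_le[of D] by (intro add_left_mono mult_left_mono) (auto simp: D_def)
  finally have "\<alpha> * (\<Sum>v\<in>pverts G. D v) \<le> \<alpha> + r" using \<alpha> by (simp add: algebra_simps)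
  then show ?thesis
    using \<alpha> unfolding D_def V r_def[symmetric] by (simp add: field_simps)
qed

section \<open>Admissible orderings and the law of the latest arc\<close>

lemma pair_digraph_sub:
  assumes "pair_digraph H" "S \<subseteq> parcs H"
  shows "pair_digraph \<lparr>pverts = pverts H, parcs = S\<rparr>"
proof -
  interpret pair_digraph H by (rule assms(1))
  show ?thesis
  proof
    show "finite (pverts \<lparr>pverts = pverts H, parcs = S\<rparr>)" "finite (parcs \<lparr>pverts = pverts H, parcs = S\<rparr>)"
      using pair_finite_verts finite_subset[OF assms(2) pair_finite_arcs] by simp_all
    fix e assume "e \<in> parcs \<lparr>pverts = pverts H, parcs = S\<rparr>"
    then have e: "e \<in> parcs H" using assms(2) by auto
    show "fst e \<in> pverts \<lparr>pverts = pverts H, parcs = S\<rparr>" "snd e \<in> pverts \<lparr>pverts = pverts H, parcs = S\<rparr>"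
      using arc_fst_in_verts[OF e] arc_snd_in_verts[OF e] by simp_all
    show "fst e \<noteq> snd e" using pair_no_loops[OF e] .
  qed
qed

lemma arrival_graph_Suc:
  assumes "m + i < length \<sigma>"
  shows "parcs (arrival_graph V m \<sigma> (Suc i)) = insert (\<sigma> ! (m + i)) (parcs (arrival_graph V m \<sigma> i))"
  using assms by (simp add: arrival_graph_def take_Suc_conv_app_nth)

lemma indeg_eq_card_arcs: "indeg G v = card {a \<in> parcs G. snd a = v}"
  by (simp add: in_degree_def in_arcs_def)

lemma admissible_iff:
  "\<sigma> \<in> admissible_orderings H m \<longleftrightarrow>
     \<sigma> \<in> permutations_of_set (parcs H) \<and> (\<forall>v\<in>pverts H. \<exists>a\<in>set (take m \<sigma>). snd a = v)"
proof -
  have "indeg (arrival_graph (pverts H) m \<sigma> 0) v \<ge> 1 \<longleftrightarrow> {a \<in> set (take m \<sigma>). snd a = v} \<noteq> {}" for v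
    unfolding indeg_eq_card_arcs One_nat_def Suc_le_eq card_gt_0_iff by (simp add: arrival_graph_def)
  also have "\<dots> v \<longleftrightarrow> (\<exists>a\<in>set (take m \<sigma>). snd a = v)" for v by blast
  finally show ?thesis by (simp only: admissible_orderings_def mem_Collect_eq)
qed

lemma finite_admissible: "finite (admissible_orderings H m)"
  by (rule finite_subset[of _ "permutations_of_set (parcs H)"]) (auto simp: admissible_iff)

text \<open>Positions count from \<open>0\<close>, so \<open>S\<close> is the arc set just after
  \<open>a\<close> has arrived. Fixing \<open>S\<close> fixes the graph, and only the identity of
  its latest arc varies.\<close>

definition last_arc :: "'v pair_pre_digraph \<Rightarrow> nat \<Rightarrow> nat \<Rightarrow> ('v \<times> 'v) set \<Rightarrow> 'v \<times> 'v \<Rightarrow> ('v \<times> 'v) list set" where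
  "last_arc H m p S a = {\<sigma> \<in> admissible_orderings H m. set (take (Suc p) \<sigma>) = S \<and> \<sigma> ! p = a}"

lemma finite_last_arc: "finite (last_arc H m p S a)"
  by (simp add: last_arc_def finite_admissible)

context
  fixes H :: "'v pair_pre_digraph" and m p :: nat
  assumes H: "pair_digraph H" and p: "m \<le> p" "p < card (parcs H)"
begin

lemma last_arc_props:
  assumes "\<sigma> \<in> last_arc H m p S a"
  shows "distinct \<sigma>" "set \<sigma> = parcs H" "p < length \<sigma>" "S \<subseteq> parcs H" "a \<in> S" "a \<notin> set (take m \<sigma>)"
    "set (take m \<sigma>) \<subseteq> S"
proof -
  have perm: "\<sigma> \<in> permutations_of_set (parcs H)" and S: "set (take (Suc p) \<sigma>) = S" and a: "\<sigma> ! p = a"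
    using assms by (auto simp: last_arc_def admissible_iff)
  show "distinct \<sigma>" "set \<sigma> = parcs H" using perm by (auto simp: permutations_of_set_def)
  then have len: "length \<sigma> = card (parcs H)" using distinct_card by fastforce
  then show plen: "p < length \<sigma>" using p by simp
  show "S \<subseteq> parcs H" using S \<open>set \<sigma> = parcs H\<close> set_take_subset by fastforce
  show "a \<in> S" using S a plen by (auto simp: take_Suc_conv_app_nth)
  show "a \<notin> set (take m \<sigma>)"
    using \<open>distinct \<sigma>\<close> a plen p by (auto simp: in_set_conv_nth nth_eq_iff_index_eq)
  show "set (take m \<sigma>) \<subseteq> S" using S p set_take_subset_set_take[of m "Suc p" \<sigma>] by simp
qed

text \<open>A permutation of \<open>S\<close> keeps the prefix set \<open>S\<close> and fixes all
  later arcs. What may fail is admissibility, and \<open>cover\<close> says that every head met by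
  the first \<open>m\<close> arcs is met again after relabelling.\<close>

lemma relabel_last_arc:
  assumes \<sigma>: "\<sigma> \<in> last_arc H m p S b" and perm: "\<pi> permutes S" and "\<pi> b = a"
    and cover: "\<And>c. c \<in> set (take m \<sigma>) \<Longrightarrow> \<exists>d\<in>set (take m \<sigma>). snd (\<pi> d) = snd c"
  shows "map \<pi> \<sigma> \<in> last_arc H m p S a"
proof -
  note props = last_arc_props[OF \<sigma>]
  have permH: "\<pi> permutes parcs H" using perm props(4) by (rule permutes_subset)
  have "map \<pi> \<sigma> \<in> permutations_of_set (parcs H)"
    using props permutes_image[OF permH] permutes_inj[OF permH]
    by (auto simp: permutations_of_set_def distinct_map inj_on_def dest: injD)
  moreover have "\<exists>a\<in>set (take m (map \<pi> \<sigma>)). snd a = v" if v: "v \<in> pverts H" for v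
  proof -
    obtain c where "c \<in> set (take m \<sigma>)" "snd c = v"
      using \<sigma> v by (auto simp: last_arc_def admissible_iff)
    with cover[of c] show ?thesis by (auto simp: take_map)
  qed
  moreover have "set (take (Suc p) (map \<pi> \<sigma>)) = S"
    using \<sigma> permutes_image[OF perm] by (simp add: last_arc_def take_map)
  moreover have "map \<pi> \<sigma> ! p = a" using \<sigma> props(3) assms(3) by (simp add: last_arc_def)
  ultimately show ?thesis by (simp add: last_arc_def admissible_iff)
qed

text \<open>
  Relabelling makes \<open>a\<close> the last arc: swap \<open>a\<close> and \<open>b\<close>, unless \<open>a\<close> is the only initial arc with its
  head; in that case \<open>a'\<close> takes its place.
\<close>
lemma card_last_arc_le:
  assumes ab: "a \<in> S" "b \<in> S" and a': "a' \<in> S" "a' \<noteq> a" "snd a' = snd a"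
  shows "card (last_arc H m p S b) \<le> 2 * card (last_arc H m p S a)"
proof -
  define \<tau> where "\<tau> = Transposition.transpose a b"
  \<comment> \<open>For distinct \<open>a\<close>, \<open>a'\<close>, \<open>b\<close> this is the
    cycle sending \<open>b\<close> to \<open>a\<close>, \<open>a\<close> to \<open>a'\<close> and
    \<open>a'\<close> to \<open>b\<close>.\<close>
  define \<pi> where "\<pi> = Transposition.transpose a b \<circ> Transposition.transpose a a'"
  have perm: "\<tau> permutes S" "\<pi> permutes S"
    unfolding \<tau>_def \<pi>_def using ab a' by (auto intro!: permutes_swap_id permutes_compose)
  have "map \<tau> \<sigma> \<in> last_arc H m p S a \<or> map \<pi> \<sigma> \<in> last_arc H m p S a" if \<sigma>: "\<sigma> \<in> last_arc H m p S b" for \<sigma>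
  proof -
    define F where "F = set (take m \<sigma>)"
    have b: "b \<notin> F" using last_arc_props(6)[OF \<sigma>] by (simp add: F_def)
    have \<tau>: "\<tau> c = c" if "c \<in> F" "c \<noteq> a" for c
      using that b by (auto simp: \<tau>_def Transposition.transpose_def)
    show ?thesis
    proof (cases "a \<in> F \<and> \<not> (\<exists>c\<in>F. c \<noteq> a \<and> snd c = snd a) \<and> a' \<noteq> b")
      case True
      \<comment> \<open>Neither \<open>a'\<close> nor \<open>b\<close> is initial, so \<pi> moves no
        initial arc but \<open>a\<close>, which keeps its head by becoming
        \<open>a'\<close>.\<close>
      then have "a' \<notin> F" using a' by auto
      have "map \<pi> \<sigma> \<in> last_arc H m p S a"
      proof (rule relabel_last_arc[OF \<sigma> perm(2)])
        have "b \<noteq> a" using True b by auto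
        then show "\<pi> b = a" using True by (auto simp add: \<pi>_def Transposition.transpose_def)
        fix c assume c: "c \<in> set (take m \<sigma>)"
        have "snd (\<pi> c) = snd c"
        proof (cases "c = a")
          case True
          then show ?thesis using a' \<open>a \<in> F \<and> _\<close> by (simp add: \<pi>_def Transposition.transpose_def)
        next
          case False
          then show ?thesis using c \<open>a' \<notin> F\<close> b by (auto simp: \<pi>_def Transposition.transpose_def F_def)
        qed
        then show "\<exists>d\<in>set (take m \<sigma>). snd (\<pi> d) = snd c" using c by blast
      qed
      then show ?thesis ..
    next
      case False
      have "map \<tau> \<sigma> \<in> last_arc H m p S a"
      proof (rule relabel_last_arc[OF \<sigma> perm(1)])
        show "\<tau> b = a" by (simp add: \<tau>_def)
        fix c assume "c \<in> set (take m \<sigma>)"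
        then have c: "c \<in> F" by (simp add: F_def)
        show "\<exists>d\<in>set (take m \<sigma>). snd (\<tau> d) = snd c"
        proof (cases "c = a")
          case True
          \<comment> \<open>Either another initial arc with the head of \<open>a\<close> survives
            the swap, or \<open>b\<close> itself has that head and inherits its role.\<close>
          with False c consider d where "d \<in> F" "d \<noteq> a" "snd d = snd a" | "a' = b" by blast
          then show ?thesis
          proof cases
            case 1
            then show ?thesis using \<tau> True F_def by metis
          next
            case 2
            then have "snd (\<tau> a) = snd c" using True a' by (simp add: \<tau>_def)
            then show ?thesis using c True F_def by blast
          qed
        next
          case False
          then show ?thesis using \<tau>[OF c] c F_def by metis
        qed
      qed
      then show ?thesis ..
    qed
  qed
  \<comment> \<open>Two preimages under injective relabellings cover the class; this is the factor
    \<open>2\<close>.\<close>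
  then have "last_arc H m p S b \<subseteq> {\<sigma>. map \<tau> \<sigma> \<in> last_arc H m p S a} \<union> {\<sigma>. map \<pi> \<sigma> \<in> last_arc H m p S a}"
    by blast
  moreover have card: "finite {\<sigma>. map f \<sigma> \<in> last_arc H m p S a} \<and> card {\<sigma>. map f \<sigma> \<in> last_arc H m p S a} \<le> card (last_arc H m p S a)"
    if "f permutes S" for f
  proof -
    have inj: "inj (map f)" using permutes_inj[OF that] by (simp add: inj_mapI)
    have vim: "{\<sigma>. map f \<sigma> \<in> last_arc H m p S a} = map f -` last_arc H m p S a" by auto
    show ?thesis unfolding vim
    proof
      show "finite (map f -` last_arc H m p S a)" by (rule finite_vimageI[OF finite_last_arc inj])
      show "card (map f -` last_arc H m p S a) \<le> card (last_arc H m p S a)"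
        by (rule card_inj_on_le[OF inj_on_subset[OF inj] _ finite_last_arc]) auto
    qed
  qed
  ultimately have "card (last_arc H m p S b) \<le> card ({\<sigma>. map \<tau> \<sigma> \<in> last_arc H m p S a} \<union> {\<sigma>. map \<pi> \<sigma> \<in> last_arc H m p S a})"
    using perm by (intro card_mono) auto
  also have "\<dots> \<le> card {\<sigma>. map \<tau> \<sigma> \<in> last_arc H m p S a} + card {\<sigma>. map \<pi> \<sigma> \<in> last_arc H m p S a}"
    by (rule card_Un_le)
  also have "\<dots> \<le> 2 * card (last_arc H m p S a)"
    using card[OF perm(1)] card[OF perm(2)] by simp
  finally show ?thesis .
qed

text \<open>Admissibility provides an initial arc with this head, and \<open>a\<close> arrives after
  the initial arcs.\<close>

lemma last_arc_head:
  assumes "\<sigma> \<in> last_arc H m p S a"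
  shows "\<exists>a'\<in>S. a' \<noteq> a \<and> snd a' = snd a"
proof -
  note props = last_arc_props[OF assms]
  have "snd a \<in> pverts H" using props(4,5) pair_wf_digraph.arc_snd_in_verts[OF pair_digraph.pair_wf_digraph[OF H]] by blast
  then obtain a' where a': "a' \<in> set (take m \<sigma>)" "snd a' = snd a"
    using assms by (auto simp: last_arc_def admissible_iff)
  then have "a' \<in> S" "a' \<noteq> a" using props(6,7) by auto
  with a'(2) show ?thesis by blast
qed

text \<open>All orderings in the class share the graph \<open>K\<close>, so the sum becomes one over
  the possible latest arcs, weighted by the class sizes \<open>q\<close>. These are nearly uniform
  on \<open>M\<close>, where \<open>arc_weight_multiple_in\<close> bounds the uniform
  average.\<close>

lemma sum_arrival_class:
  fixes \<alpha> :: real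
  assumes \<alpha>: "0 < \<alpha>" "\<alpha> < 1" and S: "S \<subseteq> parcs H"
  defines "K \<equiv> \<lparr>pverts = pverts H, parcs = S\<rparr>"
    and "X \<equiv> {\<sigma> \<in> admissible_orderings H m. set (take (Suc p) \<sigma>) = S}"
  shows "(\<Sum>\<sigma>\<in>X. push_weight \<alpha> K (\<lambda>v. real (indeg K v)) (fst (\<sigma> ! p)) / real (outdeg K (fst (\<sigma> ! p))))
    \<le> 2 * (1 + 1 / \<alpha>) * real (card X)"
proof -
  interpret K: pair_digraph K unfolding K_def by (rule pair_digraph_sub[OF H S])
  define f where "f a = push_weight \<alpha> K (\<lambda>v. real (indeg K v)) (fst a) / real (outdeg K (fst a))" for a :: "'v \<times> 'v"
  define q where "q a = real (card (last_arc H m p S a))" for a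
  define M where "M = {a \<in> parcs K. indeg K (snd a) \<ge> 2}"
  have f: "f a \<ge> 0" for a
    unfolding f_def by (intro divide_nonneg_nonneg K.push_weight_nonneg \<alpha>) auto
  have finS: "finite S" using K.pair_finite_arcs by (simp add: K_def)
  have finX: "finite X" unfolding X_def by (rule finite_subset[OF _ finite_admissible[of H m]]) auto
  have M: "a \<in> M \<longleftrightarrow> a \<in> S \<and> (\<exists>a'\<in>S. a' \<noteq> a \<and> snd a' = snd a)" for a
  proof (cases "a \<in> S")
    case True
    have fin: "finite {e \<in> S. snd e = snd a}" using finS by simp
    have "2 \<le> card {e \<in> S. snd e = snd a} \<longleftrightarrow> (\<exists>a'\<in>S. a' \<noteq> a \<and> snd a' = snd a)"
    proof
      assume "2 \<le> card {e \<in> S. snd e = snd a}"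
      then have "\<not> {e \<in> S. snd e = snd a} \<subseteq> {a}" using card_mono[of "{a}" "{e \<in> S. snd e = snd a}"] by auto
      then show "\<exists>a'\<in>S. a' \<noteq> a \<and> snd a' = snd a" by blast
    next
      assume "\<exists>a'\<in>S. a' \<noteq> a \<and> snd a' = snd a"
      then obtain a' where "a' \<in> S" "a' \<noteq> a" "snd a' = snd a" by blast
      then show "2 \<le> card {e \<in> S. snd e = snd a}"
        using card_mono[OF fin, of "{a, a'}"] True by auto
    qed
    then show ?thesis using True by (simp add: M_def K_def indeg_eq_card_arcs)
  qed (simp add: M_def K_def)
  have finM: "finite M" using finS by (rule rev_finite_subset) (auto simp: M)
  have last: "{\<sigma> \<in> X. \<sigma> ! p = a} = last_arc H m p S a" for a by (auto simp: X_def last_arc_def)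
  have sub: "(\<lambda>\<sigma>. \<sigma> ! p) ` X \<subseteq> S"
  proof (rule image_subsetI)
    fix \<sigma> assume "\<sigma> \<in> X"
    then have "\<sigma> \<in> last_arc H m p S (\<sigma> ! p)" using last[of "\<sigma> ! p"] by blast
    then show "\<sigma> ! p \<in> S" by (rule last_arc_props(5))
  qed
  have q0: "q a = 0" if "a \<in> S - M" for a
  proof -
    have "last_arc H m p S a = {}" using that last_arc_head[of _ S a] unfolding Diff_iff M by blast
    then show ?thesis by (simp add: q_def)
  qed
  have group: "(\<Sum>\<sigma>\<in>X. g (\<sigma> ! p)) = (\<Sum>a\<in>M. q a * g a)" for g :: "'v \<times> 'v \<Rightarrow> real"
  proof -
    have "(\<Sum>\<sigma>\<in>X. g (\<sigma> ! p)) = (\<Sum>a\<in>S. \<Sum>\<sigma> | \<sigma> \<in> X \<and> \<sigma> ! p = a. g (\<sigma> ! p))"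
      by (rule sum.group[OF finX finS sub, symmetric])
    also have "\<dots> = (\<Sum>a\<in>S. q a * g a)"
      by (intro sum.cong refl) (simp add: last q_def last_arc_def)
    also have "\<dots> = (\<Sum>a\<in>M. q a * g a)"
      using finS q0 M by (intro sum.mono_neutral_right) auto
    finally show ?thesis .
  qed
  have comp: "q b \<le> 2 * q a" if "a \<in> M" "b \<in> M" for a b
  proof -
    from that M obtain a' where "a \<in> S" "b \<in> S" "a' \<in> S" "a' \<noteq> a" "snd a' = snd a" by blast
    from card_last_arc_le[OF this] show ?thesis unfolding q_def by linarith
  qed
  \<comment> \<open>The maximum of \<open>q\<close> on \<open>M\<close>; the comparison up to a
    factor \<open>2\<close> bounds it by twice any other value.\<close>
  have "\<exists>Q\<ge>0. \<forall>a\<in>M. q a \<le> Q \<and> Q \<le> 2 * q a"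
  proof (cases "M = {}")
    case False
    then have "Max (q ` M) \<in> q ` M" using finM by (intro Max_in) auto
    then obtain b where b: "b \<in> M" "Max (q ` M) = q b" by auto
    have "q a \<le> q b" if "a \<in> M" for a
      unfolding b(2)[symmetric] using finM that by (intro Max_ge) auto
    with comp b(1) show ?thesis by (intro exI[of _ "q b"]) (auto simp: q_def)
  qed auto
  then obtain Q where Q: "Q \<ge> 0" "\<And>a. a \<in> M \<Longrightarrow> q a \<le> Q" "\<And>a. a \<in> M \<Longrightarrow> Q \<le> 2 * q a" by blast
  have "(\<Sum>\<sigma>\<in>X. f (\<sigma> ! p)) = (\<Sum>a\<in>M. q a * f a)" by (rule group)
  also have "\<dots> \<le> (\<Sum>a\<in>M. Q * f a)" by (intro sum_mono mult_right_mono Q f)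
  also have "\<dots> = Q * (\<Sum>(u, v)\<in>M. push_weight \<alpha> K (\<lambda>v. real (indeg K v)) u / real (outdeg K u))"
    by (simp add: f_def sum_distrib_left case_prod_unfold)
  also have "\<dots> \<le> Q * ((1 + 1 / \<alpha>) * real (card M))"
    unfolding M_def by (intro mult_left_mono K.arc_weight_multiple_in \<alpha> Q)
  also have "\<dots> = (1 + 1 / \<alpha>) * (\<Sum>a\<in>M. Q)" by simp
  also have "\<dots> \<le> (1 + 1 / \<alpha>) * (\<Sum>a\<in>M. 2 * q a)"
    using \<alpha> by (intro mult_left_mono sum_mono Q) auto
  also have "(\<Sum>a\<in>M. 2 * q a) = 2 * real (card X)"
    using group[of "\<lambda>_. 1"] by (simp add: sum_distrib_left)
  finally show ?thesis by (simp add: f_def mult_ac)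
qed

end

lemma sum_arrival_weight:
  fixes \<alpha> :: real
  assumes \<alpha>: "0 < \<alpha>" "\<alpha> < 1" and H: "pair_digraph H" and card: "card (parcs H) = m + k" and i: "i \<in> {1..k}"
  defines "K \<equiv> \<lambda>\<sigma>. arrival_graph (pverts H) m \<sigma> i"
  shows "(\<Sum>\<sigma>\<in>admissible_orderings H m. push_weight \<alpha> (K \<sigma>) (\<lambda>v. real (indeg (K \<sigma>) v)) (fst (\<sigma> ! (m + i - 1)))
      / real (outdeg (K \<sigma>) (fst (\<sigma> ! (m + i - 1)))))
    \<le> 2 * (1 + 1 / \<alpha>) * real (card (admissible_orderings H m))" (is "sum ?f ?A \<le> _")
proof -
  \<comment> \<open>The arc of update \<open>i\<close> has index \<open>m + i - 1\<close>;
    \<open>i\<close> is at least \<open>1\<close>, so the subtraction does not truncate.\<close>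
  define p where "p = m + i - 1"
  have p: "m \<le> p" "p < card (parcs H)" "Suc p = m + i" using i card by (auto simp: p_def)
  let ?S = "\<lambda>\<sigma>. set (take (Suc p) \<sigma>)"
  have "sum ?f ?A = (\<Sum>S\<in>?S ` ?A. \<Sum>\<sigma> | \<sigma> \<in> ?A \<and> ?S \<sigma> = S. ?f \<sigma>)"
    by (rule sum.image_gen[OF finite_admissible])
  also have "\<dots> \<le> (\<Sum>S\<in>?S ` ?A. 2 * (1 + 1 / \<alpha>) * real (card {\<sigma> \<in> ?A. ?S \<sigma> = S}))"
  proof (rule sum_mono)
    fix S assume "S \<in> ?S ` ?A"
    then obtain \<sigma> where "\<sigma> \<in> ?A" "S = ?S \<sigma>" by auto
    then have S: "S \<subseteq> parcs H"
      using set_take_subset[of "Suc p" \<sigma>] by (auto simp: admissible_iff permutations_of_set_def)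
    have "(\<Sum>\<sigma> | \<sigma> \<in> ?A \<and> ?S \<sigma> = S. ?f \<sigma>) = (\<Sum>\<sigma> | \<sigma> \<in> ?A \<and> ?S \<sigma> = S.
        push_weight \<alpha> \<lparr>pverts = pverts H, parcs = S\<rparr> (\<lambda>v. real (indeg \<lparr>pverts = pverts H, parcs = S\<rparr> v)) (fst (\<sigma> ! p))
          / real (outdeg \<lparr>pverts = pverts H, parcs = S\<rparr> (fst (\<sigma> ! p))))"
      by (intro sum.cong refl) (auto simp: K_def arrival_graph_def p(3), simp add: p_def)
    also have "\<dots> \<le> 2 * (1 + 1 / \<alpha>) * real (card {\<sigma> \<in> ?A. ?S \<sigma> = S})"
      by (rule sum_arrival_class[OF H p(1,2) \<alpha> S])
    finally show "(\<Sum>\<sigma> | \<sigma> \<in> ?A \<and> ?S \<sigma> = S. ?f \<sigma>) \<le> 2 * (1 + 1 / \<alpha>) * real (card {\<sigma> \<in> ?A. ?S \<sigma> = S})" .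
  qed
  also have "\<dots> = 2 * (1 + 1 / \<alpha>) * (\<Sum>S\<in>?S ` ?A. \<Sum>\<sigma> | \<sigma> \<in> ?A \<and> ?S \<sigma> = S. 1)"
    by (simp add: sum_distrib_left)
  also have "(\<Sum>S\<in>?S ` ?A. \<Sum>\<sigma> | \<sigma> \<in> ?A \<and> ?S \<sigma> = S. 1 :: real) = (\<Sum>\<sigma>\<in>?A. 1)"
    by (rule sum.image_gen[OF finite_admissible, symmetric])
  finally show ?thesis by simp
qed

section \<open>Running time under random arrivals\<close>

lemma arrival_dynamic_graph:
  assumes \<alpha>: "0 < \<alpha>" "\<alpha> < 1" and \<epsilon>: "\<epsilon> > 0" and H: "pair_digraph H" and card: "card (parcs H) = m + k"
    and \<sigma>: "\<sigma> \<in> admissible_orderings H m"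
  shows "pair_digraph (arrival_graph (pverts H) m \<sigma> i)"
    and "i < k \<Longrightarrow> parcs (arrival_graph (pverts H) m \<sigma> (Suc i)) = insert (\<sigma> ! (m + i)) (parcs (arrival_graph (pverts H) m \<sigma> i))"
    and "i < k \<Longrightarrow> \<sigma> ! (m + i) \<notin> parcs (arrival_graph (pverts H) m \<sigma> i)"
    and "dynamic_graph \<alpha> \<epsilon> (arrival_graph (pverts H) m \<sigma>) (arrival_arc m \<sigma>) k"
proof -
  have props: "distinct \<sigma>" "set \<sigma> = parcs H" using \<sigma> by (auto simp: admissible_iff permutations_of_set_def)
  then have len: "length \<sigma> = m + k" using card distinct_card by fastforce
  show graph: "pair_digraph (arrival_graph (pverts H) m \<sigma> i)" for i
    unfolding arrival_graph_def using set_take_subset[of "m + i" \<sigma>] props(2)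
    by (intro pair_digraph_sub H) auto
  show Suc: "parcs (arrival_graph (pverts H) m \<sigma> (Suc i)) = insert (\<sigma> ! (m + i)) (parcs (arrival_graph (pverts H) m \<sigma> i))"
    if "i < k" for i
    using that len by (intro arrival_graph_Suc) simp
  show new: "\<sigma> ! (m + i) \<notin> parcs (arrival_graph (pverts H) m \<sigma> i)" if "i < k" for i
    using that len props(1) by (auto simp: arrival_graph_def in_set_conv_nth nth_eq_iff_index_eq)
  show "dynamic_graph \<alpha> \<epsilon> (arrival_graph (pverts H) m \<sigma>) (arrival_arc m \<sigma>) k"
  proof (rule dynamic_graph.intro)
    fix i assume i: "i < k"
    have "fst (\<sigma> ! (m + i)) \<in> pverts (arrival_graph (pverts H) m \<sigma> (Suc i))"
      by (rule pair_wf_digraph.arc_fst_in_verts[OF pair_digraph.pair_wf_digraph[OF graph]]) (simp add: Suc[OF i])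
    then show "arc_flip (arrival_graph (pverts H) m \<sigma> i) (arrival_graph (pverts H) m \<sigma> (Suc i)) (arrival_arc m \<sigma> (Suc i))"
      using Suc[OF i] new[OF i] by (auto simp: arc_flip_def arrival_arc_def arrival_graph_def)
  qed (use \<alpha> \<epsilon> graph in auto)
qed

text \<open>The growth bound \<open>1 + r i / \<alpha>\<close> turns the coefficient
  \<open>3\<close> of \<open>n\<close> times \<epsilon> into \<open>4\<close>. Its constant part and
  the cost of the single adjustment contribute \<open>n\<close> times \<epsilon> each.\<close>

lemma arrival_sum_running_time:
  assumes \<alpha>: "0 < \<alpha>" "\<alpha> < 1" and \<epsilon>: "\<epsilon> > 0" and H: "pair_digraph H" and card: "card (parcs H) = m + k"
    and \<sigma>: "\<sigma> \<in> admissible_orderings H m" and n: "n = card (pverts H)"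
  defines "K \<equiv> arrival_graph (pverts H) m \<sigma>"
  defines "r \<equiv> \<lambda>i. push_weight \<alpha> (K i) (\<lambda>v. real (indeg (K i) v)) (fst (\<sigma> ! (m + i - 1)))
      / real (outdeg (K i) (fst (\<sigma> ! (m + i - 1))))"
  shows "(\<Sum>t\<in>pverts H. running_time \<alpha> \<epsilon> t K (arrival_arc m \<sigma>) k)
    \<le> ennreal ((real m + (\<Sum>i\<in>{1..k}. r i * ((3 + 4 * real n * \<epsilon>) / \<alpha>) + 2 * (real n * \<epsilon>))) / (\<alpha> * \<epsilon>))"
proof -
  note arrival = arrival_dynamic_graph[OF assms(1-6), folded K_def]
  interpret dynamic_graph \<alpha> \<epsilon> K "arrival_arc m \<sigma>" k by (rule arrival(4))
  define w where "w i = push_weight \<alpha> (K i) (\<lambda>v. real (indeg (K i) v))" for i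
  have V: "pverts (K i) = pverts H" for i by (simp add: K_def arrival_graph_def)
  have w0: "w i u \<ge> 0" for i u
    unfolding w_def by (intro pair_digraph.push_weight_nonneg[OF arrival(1)] \<alpha>) simp
  have w_outside: "w i u = 0" if "u \<notin> pverts (K i)" for i u
    using that by (simp add: w_def push_weight_def)
  have w_sub: "w i u \<ge> \<alpha> * real (indeg (K i) u) + (1 - \<alpha>) * (\<Sum>v\<in>pverts (K i). w i v * arc_prob (K i) v u)"
    if "u \<in> pverts (K i)" for i u
    unfolding w_def using pair_digraph.push_weight_eq[OF arrival(1) \<alpha> that] by simp
  have "(\<Sum>t\<in>pverts H. w 0 t) \<le> (\<Sum>t\<in>pverts H. real (indeg (K 0) t))"
    unfolding w_def V[of 0, symmetric] by (intro pair_digraph.sum_push_weight_le[OF arrival(1)] \<alpha>) simp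
  also have "\<dots> = real (card (set (take m \<sigma>)))"
    unfolding V[of 0, symmetric] pair_digraph.sum_indeg[OF arrival(1)] by (simp add: K_def arrival_graph_def)
  also have "\<dots> \<le> real m" using card_length[of "take m \<sigma>"] by simp
  finally have init: "(\<Sum>t\<in>pverts H. w 0 t) \<le> real m" .
  have step: "arc_weight w i * ((3 + 3 * real (card (pverts H)) * \<epsilon>) / \<alpha>) + real (card (pverts H)) * (\<epsilon> * weight_growth w i)
      + real (card (pverts H)) * (\<alpha> * \<epsilon> * real (length (arrival_arc m \<sigma> i)))
      \<le> r i * ((3 + 4 * real n * \<epsilon>) / \<alpha>) + 2 * (real n * \<epsilon>)" if i: "i \<in> {1..k}" for i
  proof -
    obtain j where j: "i = Suc j" "j < k" using i by (cases i) auto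
    have aw: "arc_weight w i = r i"
      by (simp add: arc_weight_def arrival_arc_def r_def w_def case_prod_unfold)
    have "weight_growth w i \<le> 1 + r i / \<alpha>"
      using push_weight_growth[OF \<alpha> arrival(1) arrival(1), of i j "fst (\<sigma> ! (m + j))" "snd (\<sigma> ! (m + j))"]
        arrival(2,3)[OF j(2)] j V by (simp add: weight_growth_def w_def r_def)
    then have "real n * (\<epsilon> * weight_growth w i) \<le> real n * (\<epsilon> * (1 + r i / \<alpha>))"
      using \<epsilon> by (intro mult_left_mono) auto
    moreover have "real n * (\<alpha> * \<epsilon>) \<le> real n * \<epsilon>" using \<alpha> \<epsilon> by (simp add: mult_left_mono)
    moreover have "real n * (\<epsilon> * (1 + r i / \<alpha>)) = real n * \<epsilon> + r i * (real n * \<epsilon> / \<alpha>)"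
      by (simp add: algebra_simps)
    moreover have "r i * ((3 + 4 * real n * \<epsilon>) / \<alpha>) = r i * ((3 + 3 * real n * \<epsilon>) / \<alpha>) + r i * (real n * \<epsilon> / \<alpha>)"
      by (simp add: add_divide_distrib distrib_left algebra_simps)
    ultimately show ?thesis
      unfolding aw n[symmetric] by (simp add: arrival_arc_def)
  qed
  have "((\<Sum>t\<in>pverts H. w 0 t) + (\<Sum>i\<in>{1..k}. arc_weight w i * ((3 + 3 * real (card (pverts H)) * \<epsilon>) / \<alpha>)
      + real (card (pverts H)) * (\<epsilon> * weight_growth w i) + real (card (pverts H)) * (\<alpha> * \<epsilon> * real (length (arrival_arc m \<sigma> i)))))
      / (\<alpha> * \<epsilon>) \<le> (real m + (\<Sum>i\<in>{1..k}. r i * ((3 + 4 * real n * \<epsilon>) / \<alpha>) + 2 * (real n * \<epsilon>))) / (\<alpha> * \<epsilon>)"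
    using \<alpha> \<epsilon> by (intro divide_right_mono add_mono init sum_mono step) auto
  from order_trans[OF sum_running_time_le[of w "pverts H", OF w0 w_outside w_sub] ennreal_leI[OF this]]
  show ?thesis by (simp add: V)
qed

lemma arrival_running_time:
  assumes \<alpha>: "0 < \<alpha>" "\<alpha> < 1" and \<epsilon>: "\<epsilon> > 0" and H: "pair_digraph H" "pverts H \<noteq> {}"
    and n: "n = card (pverts H)" and card: "card (parcs H) = m + k" and ne: "admissible_orderings H m \<noteq> {}"
  shows "(\<integral>\<^sup>+ (t, \<sigma>). running_time \<alpha> \<epsilon> t (arrival_graph (pverts H) m \<sigma>) (arrival_arc m \<sigma>) k
            \<partial>measure_pmf (pair_pmf (pmf_of_set (pverts H)) (pmf_of_set (admissible_orderings H m))))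
    \<le> ennreal (12 * real k / (real n * \<epsilon> * \<alpha> ^ 3) + 16 * real k / \<alpha> ^ 3 + 2 * real k / \<alpha> + real m / real n / (\<alpha> * \<epsilon>))"
proof -
  define V where "V = pverts H"
  define A where "A = admissible_orderings H m"
  have V: "finite V" "V \<noteq> {}"
    using H pair_fin_digraph.pair_finite_verts[OF pair_digraph.axioms(1)] by (auto simp: V_def)
  then have npos: "real n > 0" by (simp add: n V_def card_gt_0_iff)
  have A: "finite A" "A \<noteq> {}" using ne by (simp_all add: A_def finite_admissible)
  then have Apos: "real (card A) > 0" by (simp add: card_gt_0_iff)
  define r where "r \<sigma> i = push_weight \<alpha> (arrival_graph (pverts H) m \<sigma> i) (\<lambda>v. real (indeg (arrival_graph (pverts H) m \<sigma> i) v))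
      (fst (\<sigma> ! (m + i - 1))) / real (outdeg (arrival_graph (pverts H) m \<sigma> i) (fst (\<sigma> ! (m + i - 1))))" for \<sigma> i
  have r: "r \<sigma> i \<ge> 0" if "\<sigma> \<in> A" for \<sigma> i
    unfolding r_def
    by (intro divide_nonneg_nonneg pair_digraph.push_weight_nonneg[OF arrival_dynamic_graph(1)[OF \<alpha> \<epsilon> H(1) card that[unfolded A_def]]] \<alpha>) auto
  define c where "c = (3 + 4 * real n * \<epsilon>) / \<alpha>"
  have c: "c \<ge> 0" using \<alpha> \<epsilon> by (simp add: c_def)
  define b where "b \<sigma> = real m + (\<Sum>i\<in>{1..k}. r \<sigma> i * c + 2 * (real n * \<epsilon>))" for \<sigma>
  have b: "b \<sigma> \<ge> 0" if "\<sigma> \<in> A" for \<sigma>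
    unfolding b_def using r[OF that] c \<epsilon> by (intro add_nonneg_nonneg sum_nonneg mult_nonneg_nonneg) auto
  have swap: "(\<Sum>\<sigma>\<in>A. \<Sum>i\<in>{1..k}. r \<sigma> i * c) = (\<Sum>i\<in>{1..k}. \<Sum>\<sigma>\<in>A. r \<sigma> i) * c"
    by (subst sum.swap) (simp only: sum_distrib_right)
  have "(\<Sum>\<sigma>\<in>A. b \<sigma>) = real (card A) * (real m + real k * (2 * (real n * \<epsilon>))) + (\<Sum>i\<in>{1..k}. \<Sum>\<sigma>\<in>A. r \<sigma> i) * c"
    unfolding b_def sum.distrib swap by (simp add: algebra_simps)
  also have "(\<Sum>i\<in>{1..k}. \<Sum>\<sigma>\<in>A. r \<sigma> i) \<le> (\<Sum>i\<in>{1..k}. 2 * (1 + 1 / \<alpha>) * real (card A))"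
    unfolding r_def A_def by (rule sum_mono) (rule sum_arrival_weight[OF \<alpha> H(1) card])
  also have "\<dots> = real (card A) * (2 * (1 + 1 / \<alpha>) * real k)" by simp
  \<comment> \<open>Uses that \<open>1 + 1 / \<alpha>\<close> is at most
    \<open>2 / \<alpha>\<close>.\<close>
  also have "\<dots> \<le> real (card A) * (4 / \<alpha> * real k)"
    using \<alpha> by (intro mult_left_mono mult_right_mono) (auto simp: field_simps)
  finally have sum_b: "(\<Sum>\<sigma>\<in>A. b \<sigma>) \<le> real (card A) * (real m + real k * (2 * (real n * \<epsilon>)) + 4 / \<alpha> * real k * c)"
    using c by (simp add: algebra_simps mult_right_mono)
  have "(\<Sum>(t, \<sigma>)\<in>V \<times> A. running_time \<alpha> \<epsilon> t (arrival_graph (pverts H) m \<sigma>) (arrival_arc m \<sigma>) k)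
      = (\<Sum>\<sigma>\<in>A. \<Sum>t\<in>V. running_time \<alpha> \<epsilon> t (arrival_graph (pverts H) m \<sigma>) (arrival_arc m \<sigma>) k)"
    by (subst sum.cartesian_product[symmetric]) (rule sum.swap)
  also have "\<dots> \<le> (\<Sum>\<sigma>\<in>A. ennreal (b \<sigma> / (\<alpha> * \<epsilon>)))"
    unfolding V_def b_def r_def c_def A_def
    by (intro sum_mono arrival_sum_running_time \<alpha> \<epsilon> H(1) card n)
  also have "\<dots> = ennreal ((\<Sum>\<sigma>\<in>A. b \<sigma>) / (\<alpha> * \<epsilon>))"
    using b \<alpha> \<epsilon> by (subst sum_ennreal) (auto simp: sum_divide_distrib)
  also have "\<dots> \<le> ennreal (real (card A) * (real m + real k * (2 * (real n * \<epsilon>)) + 4 / \<alpha> * real k * c) / (\<alpha> * \<epsilon>))"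
    using \<alpha> \<epsilon> sum_b by (intro ennreal_leI divide_right_mono) auto
  finally have total: "(\<Sum>(t, \<sigma>)\<in>V \<times> A. running_time \<alpha> \<epsilon> t (arrival_graph (pverts H) m \<sigma>) (arrival_arc m \<sigma>) k)
      \<le> ennreal (real (card A) * (real m + real k * (2 * (real n * \<epsilon>)) + 4 / \<alpha> * real k * c) / (\<alpha> * \<epsilon>))" .
  \<comment> \<open>Independent uniform choices are uniform on the product, so the expectation is
    the double sum divided by \<open>n\<close> times \<open>card A\<close>.\<close>
  have "pair_pmf (pmf_of_set V) (pmf_of_set A) = pmf_of_set (V \<times> A)"
  proof (rule pmf_eqI)
    fix x
    have "V \<times> A \<noteq> {}" "finite (V \<times> A)" using V A by auto
    note pmfs = pmf_of_set[OF this] pmf_of_set[OF V(2,1)] pmf_of_set[OF A(2,1)]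
    show "pmf (pair_pmf (pmf_of_set V) (pmf_of_set A)) x = pmf (pmf_of_set (V \<times> A)) x"
      by (cases x) (simp add: pmf_pair pmfs card_cartesian_product indicator_times)
  qed
  moreover have "(\<integral>\<^sup>+ (t, \<sigma>). running_time \<alpha> \<epsilon> t (arrival_graph (pverts H) m \<sigma>) (arrival_arc m \<sigma>) k \<partial>measure_pmf (pmf_of_set (V \<times> A)))
    \<le> ennreal (12 * real k / (real n * \<epsilon> * \<alpha> ^ 3) + 16 * real k / \<alpha> ^ 3 + 2 * real k / \<alpha> + real m / real n / (\<alpha> * \<epsilon>))"
  proof (rule nn_integral_pmf_of_set_le[OF _ _ total])
    show "real (card A) * (real m + real k * (2 * (real n * \<epsilon>)) + 4 / \<alpha> * real k * c) / (\<alpha> * \<epsilon>) / real (card (V \<times> A))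
      \<le> 12 * real k / (real n * \<epsilon> * \<alpha> ^ 3) + 16 * real k / \<alpha> ^ 3 + 2 * real k / \<alpha> + real m / real n / (\<alpha> * \<epsilon>)"
      unfolding card_cartesian_product n[folded V_def, symmetric] c_def
      using npos Apos \<alpha> \<epsilon> by (simp add: field_simps power3_eq_cube)
  qed (use V A in auto)
  ultimately show ?thesis by (simp add: V_def A_def)
qed

section \<open>Absorbing the powers of \<alpha> into the constant\<close>

theorem theorem5:
  fixes \<alpha> :: real
  assumes "0 < \<alpha>" and "\<alpha> < 1"
  shows "\<exists>C>0. \<forall>\<epsilon>. 0 < \<epsilon> \<and> \<epsilon> < 1 \<longrightarrow>
    (\<forall>(G :: nat \<Rightarrow> 'v pair_pre_digraph) e k n.
       undirected_updates G e k \<and> n = card (pverts (G 0)) \<longrightarrow>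
       (\<forall>t\<in>pverts (G 0). maintains_ppr \<alpha> \<epsilon> t G (both_arcs e) k) \<and>
       (\<integral>\<^sup>+ t. running_time \<alpha> \<epsilon> t G (both_arcs e) k \<partial>measure_pmf (pmf_of_set (pverts (G 0))))
         \<le> ennreal (C * (k / \<alpha> + k / (n * \<epsilon> * \<alpha>\<^sup>2) + avg_degree (G 0) / (\<alpha> * \<epsilon>)))) \<and>
    (\<forall>(H :: 'v pair_pre_digraph) m k n.
       pair_digraph H \<and> pverts H \<noteq> {} \<and> n = card (pverts H) \<and> card (parcs H) = m + k \<and>
       admissible_orderings H m \<noteq> {} \<longrightarrow>
       (\<forall>\<sigma>\<in>admissible_orderings H m. \<forall>t\<in>pverts H.
          maintains_ppr \<alpha> \<epsilon> t (arrival_graph (pverts H) m \<sigma>) (arrival_arc m \<sigma>) k) \<and>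
       (\<integral>\<^sup>+ (t, \<sigma>). running_time \<alpha> \<epsilon> t (arrival_graph (pverts H) m \<sigma>) (arrival_arc m \<sigma>) k
            \<partial>measure_pmf (pair_pmf (pmf_of_set (pverts H)) (pmf_of_set (admissible_orderings H m))))
         \<le> ennreal (C * (k / \<alpha> + k / (n * \<epsilon> * \<alpha>\<^sup>2) + (m / n) / (\<alpha> * \<epsilon>))))"
\<comment> \<open>Since \<alpha> is constant, \<open>C\<close> may depend on it. The largest demand
  is \<open>16 / \<alpha> ^ 3 + 2 / \<alpha>\<close> per arrival, at most
  \<open>18 / \<alpha> ^ 3\<close>, to be matched against \<open>1 / \<alpha>\<close>; the other
  coefficients are smaller.\<close>
proof (intro exI[of _ "18 / \<alpha>\<^sup>2"] conjI allI impI ballI)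
  show "18 / \<alpha>\<^sup>2 > 0" using assms by simp
next
  fix \<epsilon> :: real and G :: "nat \<Rightarrow> 'v pair_pre_digraph" and e k n t
  assume "0 < \<epsilon> \<and> \<epsilon> < 1" and "undirected_updates G e k \<and> n = card (pverts (G 0))" and t: "t \<in> pverts (G 0)"
  then interpret dynamic_graph \<alpha> \<epsilon> G "both_arcs e" k
    using assms by (intro undirected_updates_dynamic_graph(2)) auto
  show "maintains_ppr \<alpha> \<epsilon> t G (both_arcs e) k" by (rule push_maintains_ppr[OF t])
next
  fix \<epsilon> :: real and G :: "nat \<Rightarrow> 'v pair_pre_digraph" and e and k n :: nat
  assume \<epsilon>: "0 < \<epsilon> \<and> \<epsilon> < 1" and U: "undirected_updates G e k \<and> n = card (pverts (G 0))"
  have "\<alpha>\<^sup>2 \<le> 1" using assms by (simp add: power_le_one)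
  then have C: "18 / \<alpha>\<^sup>2 \<ge> 18" "18 / \<alpha>\<^sup>2 \<ge> 1" using assms by (auto simp: field_simps)
  have d: "avg_degree (G 0) / (\<alpha> * \<epsilon>) \<ge> 0"
    unfolding avg_degree_def using assms \<epsilon> by (intro divide_nonneg_nonneg sum_nonneg) auto
  have "6 / \<alpha>\<^sup>2 + 2 / \<alpha> + 2 \<le> 18 / \<alpha>\<^sup>2 / \<alpha>"
  proof -
    have "1 \<le> 1 / \<alpha>" "0 \<le> 1 / \<alpha>" using assms by auto
    then have "(1 / \<alpha>) ^ 1 \<le> (1 / \<alpha>) ^ 3" "(1 / \<alpha>) ^ 2 \<le> (1 / \<alpha>) ^ 3"
      by (intro power_increasing; simp)+
    with \<open>1 \<le> 1 / \<alpha>\<close> show ?thesis by (simp add: power_divide power2_eq_square power3_eq_cube)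
  qed
  from mult_left_mono[OF this, of "real k"]
  have k: "6 * real k / \<alpha>\<^sup>2 + 2 * real k / \<alpha> + 2 * real k \<le> 18 / \<alpha>\<^sup>2 * (real k / \<alpha>)"
    by (simp add: algebra_simps)
  have "6 * (real k / (real n * \<epsilon> * \<alpha>\<^sup>2)) \<le> 18 / \<alpha>\<^sup>2 * (real k / (real n * \<epsilon> * \<alpha>\<^sup>2))"
    using C \<epsilon> by (intro mult_right_mono) auto
  moreover have "avg_degree (G 0) / (\<alpha> * \<epsilon>) \<le> 18 / \<alpha>\<^sup>2 * (avg_degree (G 0) / (\<alpha> * \<epsilon>))"
    using mult_right_mono[OF C(2) d] by simp
  ultimately have "6 * real k / (real n * \<epsilon> * \<alpha>\<^sup>2) + 6 * real k / \<alpha>\<^sup>2 + 2 * real k / \<alpha> + 2 * real k + avg_degree (G 0) / (\<alpha> * \<epsilon>)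
     \<le> 18 / \<alpha>\<^sup>2 * (real k / \<alpha> + real k / (real n * \<epsilon> * \<alpha>\<^sup>2) + avg_degree (G 0) / (\<alpha> * \<epsilon>))"
    using k unfolding distrib_left by simp
  from order_trans[OF undirected_running_time[of \<alpha> \<epsilon> G e k n] ennreal_leI[OF this]]
  show "(\<integral>\<^sup>+ t. running_time \<alpha> \<epsilon> t G (both_arcs e) k \<partial>measure_pmf (pmf_of_set (pverts (G 0))))
      \<le> ennreal (18 / \<alpha>\<^sup>2 * (k / \<alpha> + k / (n * \<epsilon> * \<alpha>\<^sup>2) + avg_degree (G 0) / (\<alpha> * \<epsilon>)))"
    using assms \<epsilon> U by simp
next
  fix \<epsilon> :: real and H :: "'v pair_pre_digraph" and m k n :: nat and \<sigma> t
  assume "0 < \<epsilon> \<and> \<epsilon> < 1" and "pair_digraph H \<and> pverts H \<noteq> {} \<and> n = card (pverts H) \<and> card (parcs H) = m + k \<and>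
       admissible_orderings H m \<noteq> {}" and "\<sigma> \<in> admissible_orderings H m" and t: "t \<in> pverts H"
  then interpret dynamic_graph \<alpha> \<epsilon> "arrival_graph (pverts H) m \<sigma>" "arrival_arc m \<sigma>" k
    using assms by (intro arrival_dynamic_graph(4)) auto
  show "maintains_ppr \<alpha> \<epsilon> t (arrival_graph (pverts H) m \<sigma>) (arrival_arc m \<sigma>) k"
    using t by (intro push_maintains_ppr) (simp add: arrival_graph_def)
next
  fix \<epsilon> :: real and H :: "'v pair_pre_digraph" and m k n :: nat
  assume \<epsilon>: "0 < \<epsilon> \<and> \<epsilon> < 1" and H: "pair_digraph H \<and> pverts H \<noteq> {} \<and> n = card (pverts H) \<and> card (parcs H) = m + k \<and>
       admissible_orderings H m \<noteq> {}"
  have "\<alpha>\<^sup>2 \<le> 1" using assms by (simp add: power_le_one)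
  then have C: "18 / \<alpha>\<^sup>2 \<ge> 1" using assms by (simp add: field_simps)
  have "16 / \<alpha> ^ 3 + 2 / \<alpha> \<le> 18 / \<alpha>\<^sup>2 / \<alpha>"
  proof -
    have "1 \<le> 1 / \<alpha>" "0 \<le> 1 / \<alpha>" using assms by auto
    then have "(1 / \<alpha>) ^ 1 \<le> (1 / \<alpha>) ^ 3" by (intro power_increasing; simp)
    then show ?thesis by (simp add: power_divide power2_eq_square power3_eq_cube)
  qed
  from mult_left_mono[OF this, of "real k"]
  have k: "16 * real k / \<alpha> ^ 3 + 2 * real k / \<alpha> \<le> 18 / \<alpha>\<^sup>2 * (real k / \<alpha>)"
    by (simp add: algebra_simps)
  have "12 / \<alpha> \<le> 18 / \<alpha>\<^sup>2" using assms by (simp add: field_simps power2_eq_square)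
  then have "12 / \<alpha> * (real k / (real n * \<epsilon> * \<alpha>\<^sup>2)) \<le> 18 / \<alpha>\<^sup>2 * (real k / (real n * \<epsilon> * \<alpha>\<^sup>2))"
    using \<epsilon> by (intro mult_right_mono) auto
  then have "12 * real k / (real n * \<epsilon> * \<alpha> ^ 3) \<le> 18 / \<alpha>\<^sup>2 * (real k / (real n * \<epsilon> * \<alpha>\<^sup>2))"
    by (simp add: power2_eq_square power3_eq_cube mult_ac)
  moreover have "real m / real n / (\<alpha> * \<epsilon>) \<le> 18 / \<alpha>\<^sup>2 * (real m / real n / (\<alpha> * \<epsilon>))"
    using mult_right_mono[OF C, of "real m / real n / (\<alpha> * \<epsilon>)"] assms \<epsilon> by simp
  ultimately have "12 * real k / (real n * \<epsilon> * \<alpha> ^ 3) + 16 * real k / \<alpha> ^ 3 + 2 * real k / \<alpha> + real m / real n / (\<alpha> * \<epsilon>)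
     \<le> 18 / \<alpha>\<^sup>2 * (real k / \<alpha> + real k / (real n * \<epsilon> * \<alpha>\<^sup>2) + real m / real n / (\<alpha> * \<epsilon>))"
    using k unfolding distrib_left by simp
  from order_trans[OF arrival_running_time[of \<alpha> \<epsilon> H n m k] ennreal_leI[OF this]]
  show "(\<integral>\<^sup>+ (t, \<sigma>). running_time \<alpha> \<epsilon> t (arrival_graph (pverts H) m \<sigma>) (arrival_arc m \<sigma>) k
            \<partial>measure_pmf (pair_pmf (pmf_of_set (pverts H)) (pmf_of_set (admissible_orderings H m))))
         \<le> ennreal (18 / \<alpha>\<^sup>2 * (k / \<alpha> + k / (n * \<epsilon> * \<alpha>\<^sup>2) + (m / n) / (\<alpha> * \<epsilon>)))"
    using assms \<epsilon> H by simp
qed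

end
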